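(* Let $X\subset\mathbb{R}^n$ be compact with $X=\{x\in\mathbb{R}^n:\ \sigma_1(x)\ge 0,\dots,\sigma_J(x)\ge 0\}$ for polynomials $\sigma_1,\dots,\sigma_J$ of degree $\le d$, and suppose there exist an integer $R$ and sum-of-squares polynomials $s_0,\dots,s_J$ with $R^2-|x|^2=s_0(x)+\sum_{j=1}^J s_j(x)\sigma_j(x)$. Let $f:X\to X$ be a polynomial map of total degree $\le d$. Let $F$ be a convex, lower semicontinuous function of a moment vector that depends only on the entries $y_\alpha$ with $|\alpha|\le d$. For each $k\in\mathbb{N}$ choose an integer $\ell\ge dk$ (possibly depending on $k$), and let $y^k\in\mathbb{R}^{\ell_x}$, $\ell_x=\binom{n+\ell}{\ell}$, be the optimal solution of the semidefinite program $$\min_{y\in\mathbb{R}^{\ell_x}} F(y)\quad\text{s.t.}\quad A_{k\ell}\,y=0,\quad y_0=1,\quad M(\sigma_j y)\succeq 0,\ j=0,1,\dots,J.$$ Let $\mu\in\Pr(X)$ be optimal for the problem of minimizing $F(y)$ over all invariant probability measures $\mu$ of $f$ on $X$, where $y_\alpha=\int_X x^\alpha\,\mathrm{d}\mu$ for all $\alpha\in\mathbb{N}_0^n$. Then there exists an increasing sequence $\{k_j\}_{j\ge1}\subset\mathbb{N}$ such that $y^{k_j}_\alpha\to\int_X x^\alpha\,\mathrm{d}\mu$ as $j\to\infty$ for all $\alpha\in\mathbb{N}_0^n$.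
   Context: $\Pr(X)$ is the set of Borel probability measures on $X$. A measure $\mu$ is invariant for $f$ if $\mu(f^{-1}(A))=\mu(A)$ for all Borel $A\subseteq X$, equivalently $\int_X (g\circ f-g)\,\mathrm{d}\mu=0$ for all $g\in C(X)$. For $x\in\mathbb{R}^n$ and $\alpha\in\mathbb{N}_0^n$, $x^\alpha=x_1^{\alpha_1}\cdots x_n^{\alpha_n}$ and $|\alpha|=\alpha_1+\dots+\alpha_n$. Vectors $y\in\mathbb{R}^{\ell_x}$ are indexed by exponents $\alpha$ with $|\alpha|\le\ell$ (entry $y_0$ corresponds to $\alpha=0$); for such $y$ let $L_y$ be the linear functional on polynomials of degree $\le\ell$ with $L_y(x^\alpha)=y_\alpha$. $p_\gamma(x)$ denotes the vector of all monomials in $x$ of degree $\le\gamma$. With $\sigma_0:=1$ and $\gamma_j=\lfloor(\ell-\deg\sigma_j)/2\rfloor$, the moment matrix $M(\sigma_j y)$ is the symmetric matrix obtained by applying $L_y$ entrywise to $\sigma_j(x)p_{\gamma_j}(x)p_{\gamma_j}(x)^\intercal$. The matrix $A_{k\ell}\in\mathbb{R}^{\binom{n+k}{k}\times\ell_x}$ is the matrix whose rows are indexed by $\alpha$ with $|\alpha|\le k$ and for which $(A_{k\ell}y)_\alpha=L_y\big((f(x))^\alpha-x^\alpha\big)$; since $(f(x))^\alpha-x^\alpha$ has degree $\le dk\le\ell$, only entries of $y$ of degree $\le dk$ appear (columns for higher-degree monomials are zero).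
   Formalization: The limit is the moment sequence of some optimal invariant measure, not of an arbitrary pre-chosen optimal μ; for a fixed μ the claim fails when the optimum is not unique (e.g. F constant, f the identity on [-1,1]). If the optimal μ is unique the two versions agree. *)

theory Defs
  imports "HOL-Analysis.Analysis" "HOL-Probability.Probability" "HOL-Library.Poly_Mapping"
begin

type_synonym 'n mpoly = "('n \<Rightarrow>\<^sub>0 nat) \<Rightarrow>\<^sub>0 real"

definition tdeg :: "('n::finite \<Rightarrow>\<^sub>0 nat) \<Rightarrow> nat" where
  "tdeg \<alpha> = (\<Sum>i\<in>UNIV. Poly_Mapping.lookup \<alpha> i)"

definition mono :: "('n::finite \<Rightarrow>\<^sub>0 nat) \<Rightarrow> real^'n \<Rightarrow> real" where
  "mono \<alpha> x = (\<Prod>i\<in>UNIV. (x $ i) ^ Poly_Mapping.lookup \<alpha> i)"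

definition peval :: "'n::finite mpoly \<Rightarrow> real^'n \<Rightarrow> real" where
  "peval p x = (\<Sum>\<alpha>\<in>Poly_Mapping.keys p. Poly_Mapping.lookup p \<alpha> * mono \<alpha> x)"

definition pdeg :: "'n::finite mpoly \<Rightarrow> nat" where
  "pdeg p = (if p = 0 then 0 else Max (tdeg ` Poly_Mapping.keys p))"

definition Var :: "'n::finite \<Rightarrow> 'n mpoly" where
  "Var i = Poly_Mapping.single (Poly_Mapping.single i 1) 1"

definition monomial :: "('n::finite \<Rightarrow>\<^sub>0 nat) \<Rightarrow> 'n mpoly" where
  "monomial \<alpha> = Poly_Mapping.single \<alpha> 1"

definition is_sos :: "'n::finite mpoly \<Rightarrow> bool" where
  "is_sos p \<longleftrightarrow> (\<exists>qs. p = sum_list (map (\<lambda>q. q * q) qs))"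

definition Lfun :: "(('n::finite \<Rightarrow>\<^sub>0 nat) \<Rightarrow> real) \<Rightarrow> 'n mpoly \<Rightarrow> real" where
  "Lfun y p = (\<Sum>\<alpha>\<in>Poly_Mapping.keys p. Poly_Mapping.lookup p \<alpha> * y \<alpha>)"

text \<open>Index set of the (localizing) moment matrix M(sigma y) at relaxation order l:
  exponents of degree at most floor((l - deg sigma)/2).\<close>
definition mm_index :: "nat \<Rightarrow> 'n::finite mpoly \<Rightarrow> ('n \<Rightarrow>\<^sub>0 nat) set" where
  "mm_index l \<sigma> = {\<beta>. int (tdeg \<beta>) \<le> (int l - int (pdeg \<sigma>)) div 2}"

definition moment_psd :: "nat \<Rightarrow> (('n::finite \<Rightarrow>\<^sub>0 nat) \<Rightarrow> real) \<Rightarrow> 'n mpoly \<Rightarrow> bool" where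
  "moment_psd l y \<sigma> \<longleftrightarrow> (\<forall>v :: ('n \<Rightarrow>\<^sub>0 nat) \<Rightarrow> real.
      0 \<le> (\<Sum>\<beta>\<in>mm_index l \<sigma>. \<Sum>\<gamma>\<in>mm_index l \<sigma>.
              v \<beta> * v \<gamma> * Lfun y (\<sigma> * monomial \<beta> * monomial \<gamma>)))"

definition Apoly :: "('n::finite \<Rightarrow> 'n mpoly) \<Rightarrow> ('n \<Rightarrow>\<^sub>0 nat) \<Rightarrow> 'n mpoly" where
  "Apoly P \<alpha> = (\<Prod>i\<in>UNIV. (P i) ^ Poly_Mapping.lookup \<alpha> i) - monomial \<alpha>"

text \<open>Feasible set of the SDP with parameters k and l. A vector of R^{l_x} is represented
  as a moment function vanishing on exponents of degree > l.\<close>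
definition sdp_feasible :: "(nat \<Rightarrow> 'n::finite mpoly) \<Rightarrow> nat \<Rightarrow> ('n \<Rightarrow> 'n mpoly) \<Rightarrow> nat \<Rightarrow> nat
    \<Rightarrow> (('n \<Rightarrow>\<^sub>0 nat) \<Rightarrow> real) \<Rightarrow> bool" where
  "sdp_feasible \<sigma> J P k l y \<longleftrightarrow>
     (\<forall>\<alpha>. l < tdeg \<alpha> \<longrightarrow> y \<alpha> = 0) \<and>
     (\<forall>\<alpha>. tdeg \<alpha> \<le> k \<longrightarrow> Lfun y (Apoly P \<alpha>) = 0) \<and>
     y 0 = 1 \<and>
     moment_psd l y 1 \<and>
     (\<forall>j\<in>{1..J}. moment_psd l y (\<sigma> j))"

definition Pmap :: "('n::finite \<Rightarrow> 'n mpoly) \<Rightarrow> real^'n \<Rightarrow> real^'n" where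
  "Pmap P x = (\<chi> i. peval (P i) x)"

definition semialg :: "(nat \<Rightarrow> 'n::finite mpoly) \<Rightarrow> nat \<Rightarrow> (real^'n) set" where
  "semialg \<sigma> J = {x. \<forall>j\<in>{1..J}. 0 \<le> peval (\<sigma> j) x}"

definition invariant_prob :: "(real^'n::finite) set \<Rightarrow> (real^'n \<Rightarrow> real^'n) \<Rightarrow> (real^'n) measure \<Rightarrow> bool" where
  "invariant_prob X f \<mu> \<longleftrightarrow>
     sets \<mu> = sets borel \<and> prob_space \<mu> \<and> emeasure \<mu> X = 1 \<and>
     (\<forall>A\<in>sets borel. A \<subseteq> X \<longrightarrow> emeasure \<mu> (f -` A \<inter> X) = emeasure \<mu> A)"

definition moment :: "(real^'n::finite) measure \<Rightarrow> ('n \<Rightarrow>\<^sub>0 nat) \<Rightarrow> real" where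
  "moment \<mu> \<alpha> = (\<integral>x. mono \<alpha> x \<partial>\<mu>)"

definition convex_fun :: "((('n::finite \<Rightarrow>\<^sub>0 nat) \<Rightarrow> real) \<Rightarrow> real) \<Rightarrow> bool" where
  "convex_fun F \<longleftrightarrow> (\<forall>y z t. 0 \<le> t \<and> t \<le> 1 \<longrightarrow>
      F (\<lambda>\<alpha>. t * y \<alpha> + (1 - t) * z \<alpha>) \<le> t * F y + (1 - t) * F z)"

definition depends_upto :: "nat \<Rightarrow> ((('n::finite \<Rightarrow>\<^sub>0 nat) \<Rightarrow> real) \<Rightarrow> real) \<Rightarrow> bool" where
  "depends_upto d F \<longleftrightarrow> (\<forall>y z. (\<forall>\<alpha>. tdeg \<alpha> \<le> d \<longrightarrow> y \<alpha> = z \<alpha>) \<longrightarrow> F y = F z)"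

text \<open>Lower semicontinuity (w.r.t. the entries of degree <= d, on which F depends).\<close>
definition lsc_fun :: "nat \<Rightarrow> ((('n::finite \<Rightarrow>\<^sub>0 nat) \<Rightarrow> real) \<Rightarrow> real) \<Rightarrow> bool" where
  "lsc_fun d F \<longleftrightarrow> (\<forall>ys z. (\<forall>\<alpha>. tdeg \<alpha> \<le> d \<longrightarrow> (\<lambda>m. ys m \<alpha>) \<longlonglongrightarrow> z \<alpha>) \<longrightarrow>
      ereal (F z) \<le> liminf (\<lambda>m. ereal (F (ys m))))"

definition optimal_inv :: "(real^'n::finite) set \<Rightarrow> (real^'n \<Rightarrow> real^'n)
    \<Rightarrow> ((('n \<Rightarrow>\<^sub>0 nat) \<Rightarrow> real) \<Rightarrow> real) \<Rightarrow> (real^'n) measure \<Rightarrow> bool" where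
  "optimal_inv X f F \<mu> \<longleftrightarrow> invariant_prob X f \<mu> \<and>
     (\<forall>\<nu>. invariant_prob X f \<nu> \<longrightarrow> F (moment \<mu>) \<le> F (moment \<nu>))"

end

(*
  The Archimedean certificate, multiplied by squares, bounds every moment along the sequence y k, so a
  diagonal subsequence converges to some z, and the functional L_z is nonnegative on all q^2 and
  q^2 sigma_j. Each affine coordinate u_i on a box satisfies L_z(q^2 u_i), L_z(q^2 (1 - u_i)) >= 0, and
  the Riesz-Nagy product argument extends this to all Bernstein products prod u_i^a (1 - u_i)^b. The
  Bernstein weights are discrete probability measures; lifting them to the line along a space-filling
  curve and applying Helly's theorem gives a measure with moments z, without a multivariate
  compactness or Riesz representation theorem. Approximating the root of the negative part of sigma_j
  by polynomials q forces the support into X, invariance follows from L_z(f^alpha - x^alpha) = 0 since polynomials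
  are dense, and optimality follows because truncated moments of any invariant measure are feasible
  while F is lower semicontinuous.
*)
theory Submission
  imports Defs "HOL-Library.Diagonal_Subsequence"
begin

section \<open>Positive functionals on commutative rings\<close>

text \<open>Semidefinite constraints give positivity on weighted squares, that is, on a quadratic
  module, which need not be closed under products; Bernstein weights, however, are products of box
  coordinates. This gap is why products of multipliers come first. Order \<open>k\<close> of the
  relaxation reaches finitely many degrees, so a fixed square is tested only from some
  \<open>k\<close> on, with a threshold depending on the square; positivity along the sequence is
  therefore phrased eventually and becomes unconditional in the limit. The ball is traded for a box
  because each coordinate then carries its own inequality c^2 - x_i^2 >= 0, and moments on the unit
  cube yield explicit discrete weights. Since the curve is onto the cube, every grid node has a
  parameter in [0,1]: tightness of the lifted measures is immediate, and continuity of the curve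
  carries the weak limit back. The set X enters only after a measure on the box exists, because
  localization is an argument about a measure and not about the functional.\<close>

lemma additive_of_nat_mult:
  fixes L :: "'a::comm_ring_1 \<Rightarrow> real"
  assumes "Modules.additive L"
  shows "L (of_nat m * p) = real m * L p"
  by (induction m)
    (simp_all add: Modules.additive.zero[OF assms] Modules.additive.add[OF assms] distrib_right)

text \<open>For the form sending q, r to \<open>L (q * r)\<close>, membership says that
  multiplication by \<open>p\<close> is a positive operator. The ring is arbitrary and
  \<open>L\<close> merely additive, so scalars appear as \<open>of_nat\<close>.\<close>

definition nonneg_mult :: "('a::comm_ring_1 \<Rightarrow> real) \<Rightarrow> 'a set" where
  "nonneg_mult L = {p. \<forall>q. 0 \<le> L (q * q * p)}"

lemma nonneg_multD: "p \<in> nonneg_mult L \<Longrightarrow> 0 \<le> L (q * q * p)"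
  by (simp add: nonneg_mult_def)

lemma nonneg_mult_add:
  assumes "Modules.additive L" "p \<in> nonneg_mult L" "q \<in> nonneg_mult L"
  shows "p + q \<in> nonneg_mult L"
  using assms by (auto simp: nonneg_mult_def distrib_left Modules.additive.add)

lemma nonneg_mult_square:
  assumes "p \<in> nonneg_mult L"
  shows "q * q * p \<in> nonneg_mult L"
proof -
  have "r * r * (q * q * p) = (r * q) * (r * q) * p" for r
    by (simp add: mult.assoc mult.left_commute)
  then have "0 \<le> L (r * r * (q * q * p))" for r
    using nonneg_multD[OF assms, of "r * q"] by (simp only:)
  then show ?thesis
    by (simp add: nonneg_mult_def)
qed

text \<open>Riesz--Nagy's argument for commuting positive operators: with
  \<open>s\<^sub>0 = a\<close> and \<open>s\<^sub>n\<^sub>+\<^sub>1 = s\<^sub>n - s\<^sub>n\<^sup>2\<close>, \<open>a\<close> is the sum of the squares \<open>s\<^sub>k\<^sup>2\<close>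
  up to a remainder which vanishes weakly.\<close>
lemma nonneg_mult_mult:
  fixes L :: "'a::comm_ring_1 \<Rightarrow> real"
  assumes L: "Modules.additive L" and 1: "1 \<in> nonneg_mult L"
    and a: "a \<in> nonneg_mult L" "1 - a \<in> nonneg_mult L" and b: "b \<in> nonneg_mult L"
  shows "a * b \<in> nonneg_mult L"
proof -
  define s where "s n = ((\<lambda>x. x - x * x) ^^ n) a" for n
  have s_Suc: "s (Suc n) = s n - s n * s n" and s_0: "s 0 = a" for n
    by (simp_all add: s_def)
  have s: "s n \<in> nonneg_mult L \<and> 1 - s n \<in> nonneg_mult L" for n
  proof (induction n)
    case 0
    then show ?case using a by (simp add: s_0)
  next
    case (Suc n)
    \<comment> \<open>With t = \<open>s n\<close>, the identity t(1 - t) = t^2 (1 - t) + (1 - t)^2 t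
      writes the next term through weighted squares of the two known members, avoiding the product
      rule being proved.\<close>
    have eq1: "s (Suc n) = s n * s n * (1 - s n) + (1 - s n) * (1 - s n) * s n"
      by (simp add: s_Suc algebra_simps)
    have eq2: "1 - s (Suc n) = (1 - s n) + s n * s n * 1"
      by (simp add: s_Suc)
    have "s (Suc n) \<in> nonneg_mult L"
      unfolding eq1 using Suc by (intro nonneg_mult_add[OF L] nonneg_mult_square) auto
    moreover have "1 - s (Suc n) \<in> nonneg_mult L"
      unfolding eq2 using Suc 1 by (intro nonneg_mult_add[OF L] nonneg_mult_square) auto
    ultimately show ?case ..
  qed
  have a_eq: "a = (\<Sum>k<n. s k * s k) + s n" for n
    by (induction n) (simp_all add: s_0 s_Suc)
  have "0 \<le> L (q * q * (a * b))" for q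
  proof -
    define e where "e n = L (q * q * (s n * s n))" for n
    have e_nonneg: "0 \<le> e n" for n
      using nonneg_multD[OF 1, of "q * s n"] by (simp add: e_def algebra_simps)
    \<comment> \<open>The squares \<open>s k * s k\<close> sum to at most \<open>a\<close> in the
      sense of \<open>L\<close>, so the series of the \<open>e k\<close> converges and its terms
      tend to 0.\<close>
    have "sum e {..<n} \<le> L (q * q * a)" for n
    proof -
      have "L (q * q * a) = sum e {..<n} + L (q * q * s n)"
        unfolding e_def Modules.additive.sum[OF L, symmetric] sum_distrib_left[symmetric]
        by (subst a_eq[of n]) (simp add: distrib_left Modules.additive.add[OF L])
      then show ?thesis
        using nonneg_multD[of "s n" L q] s by auto
    qed
    then have "summable e"
      using e_nonneg by (intro summableI_nonneg_bounded) auto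
    then have e_lim: "e \<longlonglongrightarrow> 0"
      by (rule summable_LIMSEQ_zero)
    define B where "B = L (q * q * (b * b))"
    \<comment> \<open>A Cauchy-Schwarz argument without division: expand the square of
      \<open>of_nat m * s n + b\<close>, and bound the cross term by \<open>a * b\<close>, from
      which it differs by squares times \<open>b\<close>. Letting \<open>n\<close> tend to infinity
      for fixed \<open>m\<close> removes \<open>e n\<close>; a large \<open>m\<close> then excludes
      a negative value.\<close>
    have le: "- (real m * real m * e n) - B \<le> 2 * real m * L (q * q * (a * b))" for m n
    proof -
      have "q * q * (a * b) = (\<Sum>k<n. (q * s k) * (q * s k) * b) + q * q * (s n * b)"
        by (subst a_eq[of n]) (simp add: algebra_simps sum_distrib_left)
      moreover have "0 \<le> L (\<Sum>k<n. (q * s k) * (q * s k) * b)"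
        unfolding Modules.additive.sum[OF L] by (intro sum_nonneg nonneg_multD b)
      ultimately have 1: "L (q * q * (s n * b)) \<le> L (q * q * (a * b))"
        by (simp add: Modules.additive.add[OF L])
      have of_2: "L (2 * p) = 2 * L p" for p
        using additive_of_nat_mult[OF L, of 2] by simp
      let ?r = "q * (of_nat m * s n + b)"
      have "?r * ?r * 1 = of_nat m * (of_nat m * (q * q * (s n * s n)))
          + 2 * (of_nat m * (q * q * (s n * b))) + q * q * (b * b)"
        by (simp add: algebra_simps)
      then have "0 \<le> real m * (real m * e n) + 2 * (real m * L (q * q * (s n * b))) + B"
        using nonneg_multD[OF \<open>1 \<in> nonneg_mult L\<close>, of ?r]
        by (simp only: Modules.additive.add[OF L] additive_of_nat_mult[OF L] of_2 e_def B_def)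
      then show ?thesis
        using mult_left_mono[OF 1, of "2 * real m"] by (simp add: mult.assoc)
    qed
    have "- B \<le> 2 * real m * L (q * q * (a * b))" for m
    proof (rule LIMSEQ_le_const2)
      show "(\<lambda>n. - (real m * real m * e n) - B) \<longlonglongrightarrow> - B"
        using tendsto_diff[OF tendsto_minus[OF tendsto_mult_left[OF e_lim]] tendsto_const] by simp
    qed (use le in blast)
    then have le': "- B \<le> real m * (2 * L (q * q * (a * b)))" for m
      by (simp only: mult.assoc mult.left_commute[of _ 2])
    show ?thesis
    proof (rule ccontr)
      assume "\<not> 0 \<le> L (q * q * (a * b))"
      then obtain m where "B < real m * - (2 * L (q * q * (a * b)))"
        using reals_Archimedean3[of "- (2 * L (q * q * (a * b)))"] by auto
      then show False
        using le'[of m] by simp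
    qed
  qed
  then show ?thesis
    by (simp add: nonneg_mult_def)
qed

section \<open>A space-filling curve\<close>

text \<open>A clipped cosine in place of Schoenberg's piecewise linear wave: continuous and
  2-periodic by construction, equal to 0 on [0, 1/3] and to 1 on [2/3, 1] because cos (pi / 3) =
  1/2.\<close>

definition schoenberg_wave :: "real \<Rightarrow> real" where
  "schoenberg_wave x = max 0 (min 1 (1 / 2 - cos (pi * x)))"

lemma schoenberg_wave_bounds: "0 \<le> schoenberg_wave x" "schoenberg_wave x \<le> 1"
  by (simp_all add: schoenberg_wave_def)

lemma continuous_on_schoenberg_wave [continuous_intros]:
  fixes f :: "'a::t2_space \<Rightarrow> real"
  shows "continuous_on S f \<Longrightarrow> continuous_on S (\<lambda>x. schoenberg_wave (f x))"
  unfolding schoenberg_wave_def by (intro continuous_intros)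

lemma schoenberg_wave_periodic: "schoenberg_wave (x + 2 * of_nat m) = schoenberg_wave x"
proof -
  have "cos (pi * (x + 2 * of_nat m)) = cos (pi * x + 2 * real m * pi)"
    by (simp add: algebra_simps)
  also have "\<dots> = cos (pi * x)"
    by (simp only: cos_add cos_2npi sin_2npi mult_1_right mult_zero_right diff_zero)
  finally show ?thesis by (simp add: schoenberg_wave_def)
qed

lemma schoenberg_wave_digit:
  assumes "b \<le> 1" "0 \<le> r" "r \<le> 1 / 3"
  shows "schoenberg_wave (2 * real b / 3 + r) = real b"
proof (cases "b = 0")
  case True
  have "cos (pi / 3) \<le> cos (pi * r)"
    using assms by (intro cos_monotone_0_pi_le) auto
  then show ?thesis
    using True by (simp add: schoenberg_wave_def cos_60)
next
  case False
  then have b: "b = 1" using assms by simp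
  have "cos (pi / 3) \<le> cos (pi * (1 / 3 - r))"
    using assms by (intro cos_monotone_0_pi_le) (auto simp: algebra_simps)
  also have "cos (pi * (1 / 3 - r)) = - cos (pi * (2 / 3 + r))"
    using cos_pi_minus[of "pi * (2 / 3 + r)"] by (simp add: algebra_simps)
  finally show ?thesis
    using b by (simp add: schoenberg_wave_def cos_60)
qed

text \<open>All ternary digits are 0 or 2. Scaling by \<open>3 ^ m\<close> turns the digits before
  position \<open>m\<close> into an even integer, absorbed by the period, while the digits after it
  contribute at most 1/3, within the plateau of the wave.\<close>

lemma schoenberg_wave_expansion:
  assumes "\<And>k. b k \<le> (1::nat)"
  shows "schoenberg_wave (3 ^ m * (suminf (\<lambda>k. 2 * real (b k) / 3 ^ Suc k))) = real (b m)"
proof -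
  define c where "c k = 2 * real (b k) / 3 ^ Suc k" for k
  have geo: "(\<lambda>k. 2 / 3 ^ Suc k :: real) sums 1"
    using sums_mult[OF geometric_sums[of "1 / 3 :: real"], of "2 / 3"]
    by (simp add: power_divide)
  have c_le: "c k \<le> 2 / 3 ^ Suc k" and c_nonneg: "0 \<le> c k" for k
    using assms[of k] by (auto simp: c_def divide_right_mono)
  have summ: "summable c"
    by (rule summable_comparison_test'[OF sums_summable[OF geo]]) (use c_le c_nonneg in auto)
  define r where "r = (suminf (\<lambda>k. c (k + Suc m))) * 3 ^ m"
  have summ': "summable (\<lambda>k. c (k + Suc m))"
    using summ by (rule summable_ignore_initial_segment)
  have "0 \<le> r"
    unfolding r_def by (intro mult_nonneg_nonneg suminf_nonneg summ' c_nonneg) auto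
  moreover have "r \<le> 1 / 3"
  proof -
    have "(\<lambda>k. (1 / 3 ^ Suc m) * (2 / 3 ^ Suc k) :: real) sums (1 / 3 ^ Suc m * 1)"
      by (intro sums_mult geo)
    then have "(\<lambda>k. 2 / 3 ^ Suc (k + Suc m) :: real) sums (1 / 3 ^ Suc m)"
      by (simp add: power_add algebra_simps)
    then have "(suminf (\<lambda>k. c (k + Suc m))) \<le> 1 / 3 ^ Suc m"
      using suminf_le[OF c_le summ' sums_summable] sums_unique by fastforce
    then show ?thesis
      unfolding r_def by (simp add: field_simps)
  qed
  moreover have "3 ^ m * (suminf (\<lambda>k. c k)) = 2 * real (b m) / 3 + r + 2 * of_nat (\<Sum>k<m. b k * 3 ^ (m - Suc k))"
  proof -
    have "(suminf (\<lambda>k. c k)) = (suminf (\<lambda>k. c (k + Suc m))) + (\<Sum>k<m. c k) + c m"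
      using suminf_split_initial_segment[OF summ, of "Suc m"] by simp
    moreover have "3 ^ m * c k = 2 * real (b k * 3 ^ (m - Suc k))" if "k < m" for k
    proof -
      have "(3::real) ^ m = 3 ^ Suc k * 3 ^ (m - Suc k)"
        using that by (subst power_add[symmetric]) simp
      then show ?thesis by (simp add: c_def)
    qed
    ultimately show ?thesis
      by (simp add: algebra_simps r_def c_def sum_distrib_left)
  qed
  ultimately show ?thesis
    using assms[of m] unfolding c_def[symmetric]
    by (simp only: schoenberg_wave_periodic schoenberg_wave_digit)
qed

lemma binary_expansion:
  fixes x :: real
  assumes "0 \<le> x" "x \<le> 1"
  obtains b :: "nat \<Rightarrow> nat" where "\<And>k. b k \<le> 1" "(\<lambda>k. (1 / 2) ^ Suc k * real (b k)) sums x"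
\<comment> \<open>The telescoping below needs \<open>f 0 = 0\<close>, which fails at
  \<open>x = 1\<close>; there all digits are 1.\<close>
proof (cases "x = 1")
  case True
  then show ?thesis
    using that[of "\<lambda>_. 1"] power_half_series by simp
next
  case False
  define f where "f k = \<lfloor>2 ^ k * x\<rfloor>" for k
  have f: "2 * f k \<le> f (Suc k)" "f (Suc k) \<le> 2 * f k + 1" for k
    unfolding f_def by (simp_all add: le_floor_iff floor_le_iff) linarith+
  define b where "b k = nat (f (Suc k) - 2 * f k)" for k
  have b_real: "real (b k) = of_int (f (Suc k)) - 2 * of_int (f k)" for k
    using f[of k] by (simp add: b_def)
  have "(\<Sum>k<m. (1 / 2) ^ Suc k * real (b k)) = of_int (f m) / 2 ^ m" for m
  proof (induction m)
    case 0
    have "f 0 = 0" using assms False by (simp add: f_def floor_eq_iff)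
    then show ?case by simp
  next
    case (Suc m)
    then show ?case by (simp add: b_real field_simps)
  qed
  moreover have "(\<lambda>m. of_int (f m) / 2 ^ m) \<longlonglongrightarrow> x"
  proof (rule tendsto_sandwich)
    show "\<forall>\<^sub>F m in sequentially. x - (1 / 2) ^ m \<le> of_int (f m) / 2 ^ m"
    proof (rule always_eventually, rule allI)
      fix m
      have "2 ^ m * x - 1 \<le> of_int (f m)" unfolding f_def by linarith
      then have "(2 ^ m * x - 1) / 2 ^ m \<le> of_int (f m) / 2 ^ m"
        by (intro divide_right_mono) auto
      then show "x - (1 / 2) ^ m \<le> of_int (f m) / 2 ^ m"
        by (simp add: diff_divide_distrib power_one_over)
    qed
    show "\<forall>\<^sub>F m in sequentially. of_int (f m) / 2 ^ m \<le> x"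
      unfolding f_def by (intro always_eventually allI) (simp add: field_simps)
    show "(\<lambda>m. x - (1 / 2) ^ m) \<longlonglongrightarrow> x"
      using tendsto_diff[OF tendsto_const LIMSEQ_realpow_zero[of "1/2"]] by fastforce
  qed simp
  ultimately have "(\<lambda>k. (1 / 2) ^ Suc k * real (b k)) sums x"
    by (simp add: sums_def)
  moreover have "b k \<le> 1" for k
    using f[of k] by (simp add: b_def)
  ultimately show ?thesis using that by blast
qed

text \<open>Schoenberg's space-filling curve: coordinate \<open>i\<close> reads the ternary digits whose position is
  congruent to the index of \<open>i\<close> modulo the dimension.\<close>
lemma space_filling_curve:
  obtains \<phi> :: "real \<Rightarrow> real ^ 'n::finite" where
    "continuous_on UNIV \<phi>" "\<And>t i. 0 \<le> \<phi> t $ i" "\<And>t i. \<phi> t $ i \<le> 1"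
    "\<And>x. (\<And>i. 0 \<le> x $ i \<and> x $ i \<le> 1) \<Longrightarrow> \<exists>t\<in>{0..1}. \<phi> t = x"
proof -
  let ?n = "CARD('n)"
  obtain e :: "'n \<Rightarrow> nat" where e: "bij_betw e UNIV {0..<?n}"
    using ex_bij_betw_finite_nat[OF finite_class.finite_UNIV] by blast
  have e_less: "e i < ?n" for i
    using e by (auto simp: bij_betw_def)
  define g where "g i k t = (1 / 2) ^ Suc k * schoenberg_wave (3 ^ (?n * k + e i) * t)" for i k t
  define \<phi> where "\<phi> t = (\<chi> i. suminf (\<lambda>k. g i k t))" for t
  have g_bounds: "0 \<le> g i k t" "g i k t \<le> (1 / 2) ^ Suc k" for i k t
    using schoenberg_wave_bounds by (auto simp: g_def intro!: mult_left_le)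
  have half: "summable (\<lambda>k. (1 / 2 :: real) ^ Suc k)"
    using power_half_series sums_summable by blast
  have g_summable: "summable (\<lambda>k. g i k t)" for i t
    by (rule summable_comparison_test'[OF half]) (use g_bounds in \<open>auto simp del: power_Suc\<close>)
  have "continuous_on UNIV (\<lambda>t. suminf (\<lambda>k. g i k t))" for i
  proof (rule uniform_limit_theorem[where F = sequentially])
    show "uniform_limit UNIV (\<lambda>n t. \<Sum>k<n. g i k t) (\<lambda>t. suminf (\<lambda>k. g i k t)) sequentially"
      by (rule Weierstrass_m_test[OF _ half]) (use g_bounds in \<open>auto simp del: power_Suc\<close>)
    show "\<forall>\<^sub>F n in sequentially. continuous_on UNIV (\<lambda>t. \<Sum>k<n. g i k t)"
      unfolding g_def by (intro always_eventually allI continuous_intros)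
  qed simp
  then have 1: "continuous_on UNIV \<phi>"
    unfolding \<phi>_def by (intro continuous_on_vec_lambda)
  have 2: "0 \<le> \<phi> t $ i" for t i
    by (simp add: \<phi>_def suminf_nonneg g_summable g_bounds)
  have 3: "\<phi> t $ i \<le> 1" for t i
  proof -
    have "(suminf (\<lambda>k. g i k t)) \<le> (suminf (\<lambda>k. (1 / 2) ^ Suc k))"
      by (intro suminf_le g_bounds g_summable half)
    then show ?thesis
      using power_half_series by (simp add: \<phi>_def sums_iff)
  qed
  have "\<exists>t\<in>{0..1}. \<phi> t = x" if x: "\<And>i. 0 \<le> x $ i \<and> x $ i \<le> 1" for x
  proof -
    have "\<exists>b. (\<forall>k. b k \<le> (1::nat)) \<and> (\<lambda>k. (1 / 2) ^ Suc k * real (b k)) sums (x $ i)" for i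
      by (rule binary_expansion[of "x $ i"]) (use x in auto)
    then obtain b where b: "\<And>i k. b i k \<le> (1::nat)"
      "\<And>i. (\<lambda>k. (1 / 2) ^ Suc k * real (b i k)) sums (x $ i)"
      by metis
    \<comment> \<open>Interleaves the binary expansions of the coordinates; position
      \<open>?n * k + e i\<close>, where \<open>g i k\<close> looks, holds bit \<open>k\<close> of
      coordinate \<open>i\<close>.\<close>
    define a where "a m = b (the_inv e (m mod ?n)) (m div ?n)" for m
    have a_le: "a m \<le> 1" for m
      unfolding a_def by (rule b(1))
    have inj: "inj e" using e by (simp add: bij_betw_def)
    have a: "a (?n * k + e i) = b i k" for i k
      using e_less[of i] by (simp add: a_def the_inv_f_f[OF inj])
    define t where "t = (suminf (\<lambda>k. 2 * real (a k) / 3 ^ Suc k))"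
    have "schoenberg_wave (3 ^ m * t) = real (a m)" for m
      unfolding t_def by (rule schoenberg_wave_expansion) (rule a_le)
    then have "\<phi> t = x"
      using b(2) by (simp add: \<phi>_def g_def a sums_iff vec_eq_iff)
    moreover have "0 \<le> t \<and> t \<le> 1"
    proof -
      have geo: "(\<lambda>k. 2 / 3 ^ Suc k :: real) sums 1"
        using sums_mult[OF geometric_sums[of "1 / 3 :: real"], of "2 / 3"]
        by (simp add: power_divide)
      have le: "2 * real (a k) / 3 ^ Suc k \<le> 2 / 3 ^ Suc k" for k
        using a_le[of k] by (intro divide_right_mono) auto
      have summ: "summable (\<lambda>k. 2 * real (a k) / 3 ^ Suc k)"
        by (rule summable_comparison_test'[OF sums_summable[OF geo]]) (use le in auto)
      show ?thesis
        unfolding t_def using suminf_le[OF le summ sums_summable[OF geo]] suminf_nonneg[OF summ]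
          sums_unique[OF geo] by auto
    qed
    ultimately show ?thesis by auto
  qed
  then show ?thesis using that 1 2 3 by blast
qed

section \<open>The Hausdorff moment problem\<close>

text \<open>The factorial moments of the binomial distribution, as an identity in any commutative
  ring so that it applies with a polynomial in place of \<open>x\<close>. It makes the Bernstein
  weights reproduce \<open>L\<close> exactly on binomial ratios.\<close>

lemma sum_binomial_choose:
  fixes x :: "'a::comm_ring_1"
  assumes "a \<le> N"
  shows "(\<Sum>k\<le>N. of_nat (k choose a) * (of_nat (N choose k) * (x ^ k * (1 - x) ^ (N - k))))
    = of_nat (N choose a) * x ^ a"
proof -
  have "(\<Sum>k\<le>N. of_nat (k choose a) * (of_nat (N choose k) * (x ^ k * (1 - x) ^ (N - k))))
    = (\<Sum>k\<in>{a..N}. of_nat (k choose a) * (of_nat (N choose k) * (x ^ k * (1 - x) ^ (N - k))))"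
    by (rule sum.mono_neutral_right) (auto simp: not_le binomial_eq_0)
  also have "\<dots> = (\<Sum>j\<le>N - a. of_nat ((a + j) choose a) *
      (of_nat (N choose (a + j)) * (x ^ (a + j) * (1 - x) ^ (N - (a + j)))))"
    by (rule sum.reindex_bij_witness[where i = "\<lambda>j. a + j" and j = "\<lambda>k. k - a"])
      (use assms in auto)
  also have "\<dots> = (\<Sum>j\<le>N - a. of_nat (N choose a) * x ^ a *
      (of_nat ((N - a) choose j) * x ^ j * (1 - x) ^ (N - a - j)))"
  proof (rule sum.cong)
    fix j assume "j \<in> {..N - a}"
    then have "(N choose (a + j)) * ((a + j) choose a) = (N choose a) * ((N - a) choose j)"
      using choose_mult[of a "a + j" N] assms by simp
    then have "(of_nat (N choose (a + j)) * of_nat ((a + j) choose a) :: 'a)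
        = of_nat (N choose a) * of_nat ((N - a) choose j)"
      by (metis of_nat_mult)
    then have "of_nat ((a + j) choose a) * (of_nat (N choose (a + j)) * c)
        = of_nat (N choose a) * (of_nat ((N - a) choose j) * c)" for c :: 'a
      by (simp add: mult.assoc[symmetric] mult.commute[of "of_nat ((a + j) choose a)"])
    then show "of_nat ((a + j) choose a) *
        (of_nat (N choose (a + j)) * (x ^ (a + j) * (1 - x) ^ (N - (a + j)))) =
      of_nat (N choose a) * x ^ a * (of_nat ((N - a) choose j) * x ^ j * (1 - x) ^ (N - a - j))"
      by (simp add: power_add mult.assoc mult.left_commute)
  qed simp
  also have "\<dots> = of_nat (N choose a) * x ^ a * (x + (1 - x)) ^ (N - a)"
    by (simp only: binomial_ring sum_distrib_left)
  finally show ?thesis by simp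
qed

text \<open>The ratio is a product of factors (k - j) / (N - j) with j < a. Each lies in [0, 1] and
  within j / N of k / N, so the errors add up to at most a^2 / N.\<close>

lemma choose_ratio_approx:
  assumes "k \<le> N" "a \<le> N" "0 < N"
  shows "\<bar>real (k choose a) / real (N choose a) - (real k / real N) ^ a\<bar> \<le> real a * real a / real N"
  using \<open>a \<le> N\<close>
proof (induction a)
  case (Suc a)
  have Suc_choose: "real (n choose Suc a) = real (n - a) / real (Suc a) * real (n choose a)" for n
  proof (cases "a < n")
    case True
    then obtain b where "n = Suc (a + b)" by (metis less_imp_Suc_add)
    then have "Suc a * (n choose Suc a) = (n - a) * (n choose a)"
      using Suc_times_binomial_add[of a b] by simp
    then have "real (Suc a) * real (n choose Suc a) = real (n - a) * real (n choose a)"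
      by (metis of_nat_mult)
    then show ?thesis by (simp add: field_simps)
  qed (auto simp: not_less le_eq_less_or_eq)
  define q where "q = real (k - a) / real (N - a)"
  define \<rho> where "\<rho> = real (k choose a) / real (N choose a)"
  define x where "x = real k / real N"
  have \<rho>: "real (k choose Suc a) / real (N choose Suc a) = \<rho> * q"
    unfolding Suc_choose q_def \<rho>_def by (simp del: of_nat_Suc add: times_divide_times_eq mult.commute)
  have x: "0 \<le> x" "x \<le> 1" using assms by (auto simp: x_def)
  have q: "\<bar>q\<bar> \<le> 1" using assms Suc.prems by (auto simp: q_def)
  have "\<bar>q - x\<bar> \<le> real a / real N"
  proof (cases "a \<le> k")
    case True
    have eq: "x - q = (real a / real N) * (real (N - k) / real (N - a))"
      using True assms Suc.prems by (simp add: x_def q_def field_simps of_nat_diff)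
    have "\<bar>q - x\<bar> = \<bar>x - q\<bar>"
      by (rule abs_minus_commute)
    also have "\<dots> = (real a / real N) * (real (N - k) / real (N - a))"
      unfolding eq by (rule abs_of_nonneg) simp
    also have "\<dots> \<le> real a / real N"
      using True Suc.prems by (intro mult_left_le) auto
    finally show ?thesis .
  \<comment> \<open>For \<open>k < a\<close> truncated subtraction makes \<open>q = 0\<close>, and
    \<open>x\<close> itself is below \<open>a / N\<close>.\<close>
  next
    case False
    then show ?thesis using assms by (auto simp: q_def x_def divide_right_mono)
  qed
  moreover have "\<bar>x ^ a * (q - x)\<bar> \<le> \<bar>q - x\<bar>"
    using x by (simp add: abs_mult power_le_one mult_left_le_one_le)
  ultimately have 1: "\<bar>x ^ a * (q - x)\<bar> \<le> real a / real N"
    by linarith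
  have "\<bar>(\<rho> - x ^ a) * q\<bar> \<le> \<bar>\<rho> - x ^ a\<bar>"
    using q by (simp add: abs_mult mult_left_le)
  also have "\<dots> \<le> real a * real a / real N"
    using Suc unfolding \<rho>_def x_def by simp
  finally have "\<bar>\<rho> * q - x ^ Suc a\<bar> \<le> real a * real a / real N + real a / real N"
    using 1 by (simp add: algebra_simps abs_le_iff)
  also have "\<dots> \<le> real (Suc a) * real (Suc a) / real N"
    by (simp add: add_divide_distrib[symmetric] divide_right_mono algebra_simps)
  finally show ?case
    unfolding \<rho> x_def .
qed simp

lemma choose_ratio_le_1:
  assumes "k \<le> N"
  shows "real (k choose a) / real (N choose a) \<le> 1"
  using binomial_right_mono[OF assms, of a] by (cases "a \<le> N") (simp_all add: divide_le_eq_1)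

lemma nonneg_mult_of_nat:
  assumes "Modules.additive L" "p \<in> nonneg_mult L"
  shows "of_nat m * p \<in> nonneg_mult L"
proof (induction m)
  case 0
  then show ?case by (simp add: nonneg_mult_def Modules.additive.zero[OF assms(1)])
next
  case (Suc m)
  then show ?case using nonneg_mult_add[OF assms] by (simp add: distrib_right)
qed

lemma nonneg_mult_power_mult:
  assumes "Modules.additive L" "1 \<in> nonneg_mult L" "a \<in> nonneg_mult L" "1 - a \<in> nonneg_mult L"
    "b \<in> nonneg_mult L"
  shows "a ^ m * b \<in> nonneg_mult L"
  by (induction m) (use assms nonneg_mult_mult in \<open>auto simp: mult.assoc\<close>)

text \<open>Factors are peeled off one at a time: \<open>nonneg_mult_mult\<close> asks that the
  factor and its complement to 1 both be multipliers, which holds for \<open>u i\<close> and for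
  \<open>1 - u i\<close> alike.\<close>

lemma nonneg_mult_bernstein:
  fixes L :: "'a::comm_ring_1 \<Rightarrow> real"
  assumes L: "Modules.additive L" and 1: "1 \<in> nonneg_mult L"
    and u: "\<And>i. u i \<in> nonneg_mult L" "\<And>i. 1 - u i \<in> nonneg_mult L"
    and "finite I"
  shows "(\<Prod>i\<in>I. of_nat (c i) * (u i ^ a i * (1 - u i) ^ b i)) \<in> nonneg_mult L"
  using \<open>finite I\<close>
proof induction
  case (insert i I)
  have "of_nat (c i) * (u i ^ a i *
      ((1 - u i) ^ b i * (\<Prod>i\<in>I. of_nat (c i) * (u i ^ a i * (1 - u i) ^ b i)))) \<in> nonneg_mult L"
    using insert.IH by (intro nonneg_mult_of_nat[OF L] nonneg_mult_power_mult[OF L 1]) (simp_all add: u)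
  then show ?case
    using insert.hyps by (simp add: mult.assoc)
qed (simp add: 1)

text \<open>The discrete measures built from the Bernstein weights \<open>w N\<close> are lifted along a space-filling curve
  to the real line, where Helly's selection theorem provides a weak limit.\<close>
lemma hausdorff_moment_problem:
  fixes L :: "'a::comm_ring_1 \<Rightarrow> real" and u :: "'n::finite \<Rightarrow> 'a"
  assumes L: "Modules.additive L" and L1: "L 1 = 1" and 1: "1 \<in> nonneg_mult L"
    and u: "\<And>i. u i \<in> nonneg_mult L" "\<And>i. 1 - u i \<in> nonneg_mult L"
  obtains \<mu> :: "(real ^ 'n) measure" where "prob_space \<mu>" "sets \<mu> = sets borel"
    "AE x in \<mu>. \<forall>i. 0 \<le> x $ i \<and> x $ i \<le> 1"
    "\<And>\<alpha>. (\<integral>x. (\<Prod>i\<in>UNIV. (x $ i) ^ \<alpha> i) \<partial>\<mu>) = L (\<Prod>i\<in>UNIV. u i ^ \<alpha> i)"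
proof -
  obtain \<phi> :: "real \<Rightarrow> real ^ 'n" where \<phi>: "continuous_on UNIV \<phi>"
    "\<And>t i. 0 \<le> \<phi> t $ i" "\<And>t i. \<phi> t $ i \<le> 1"
    "\<And>x. (\<And>i. 0 \<le> x $ i \<and> x $ i \<le> 1) \<Longrightarrow> \<exists>t\<in>{0..1}. \<phi> t = x"
    using space_filling_curve by metis
  define K where "K N = PiE (UNIV :: 'n set) (\<lambda>_. {..N::nat})" for N
  have fin: "finite (K N)" for N
    unfolding K_def by (intro finite_PiE) auto
  define W where "W N k = (\<Prod>i\<in>UNIV. of_nat (N choose k i) * (u i ^ k i * (1 - u i) ^ (N - k i)))" for N k
  define w where "w N k = L (W N k)" for N k
  have w_nonneg: "0 \<le> w N k" for N k
  proof -
    have "W N k \<in> nonneg_mult L"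
      unfolding W_def by (intro nonneg_mult_bernstein L 1 u) simp
    from nonneg_multD[OF this, of 1] show ?thesis
      by (simp add: w_def)
  qed
  \<comment> \<open>Apply \<open>L\<close> to the product over the coordinates of
    \<open>sum_binomial_choose\<close>. The only error left is that of replacing binomial ratios by
    powers of the grid points \<open>k i / N\<close>.\<close>
  have exact: "(\<Sum>k\<in>K N. w N k * (\<Prod>i\<in>UNIV. real (k i choose \<alpha> i) / real (N choose \<alpha> i)))
      = L (\<Prod>i\<in>UNIV. u i ^ \<alpha> i)" if "\<And>i. \<alpha> i \<le> N" for N \<alpha>
  proof -
    have "(\<Prod>i\<in>UNIV. of_nat (N choose \<alpha> i) * u i ^ \<alpha> i)
        = (\<Prod>i\<in>UNIV. \<Sum>k\<le>N. of_nat (k choose \<alpha> i) * (of_nat (N choose k) * (u i ^ k * (1 - u i) ^ (N - k))))"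
      by (intro prod.cong refl sum_binomial_choose[symmetric] that)
    also have "\<dots> = (\<Sum>k\<in>K N. \<Prod>i\<in>UNIV. of_nat (k i choose \<alpha> i) *
          (of_nat (N choose k i) * (u i ^ k i * (1 - u i) ^ (N - k i))))"
      unfolding K_def by (intro prod_sum_PiE) auto
    also have "\<dots> = (\<Sum>k\<in>K N. of_nat (\<Prod>i\<in>UNIV. k i choose \<alpha> i) * W N k)"
      by (simp only: prod.distrib of_nat_prod W_def)
    finally have "of_nat (\<Prod>i\<in>UNIV. N choose \<alpha> i) * (\<Prod>i\<in>UNIV. u i ^ \<alpha> i) = \<dots>"
      by (simp only: prod.distrib of_nat_prod)
    from arg_cong[OF this, of L]
    have "real (\<Prod>i\<in>UNIV. N choose \<alpha> i) * L (\<Prod>i\<in>UNIV. u i ^ \<alpha> i)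
        = (\<Sum>k\<in>K N. real (\<Prod>i\<in>UNIV. k i choose \<alpha> i) * w N k)"
      unfolding Modules.additive.sum[OF L] additive_of_nat_mult[OF L] w_def .
    moreover have "real (\<Prod>i\<in>UNIV. N choose \<alpha> i) \<noteq> 0"
      using that by (simp add: not_less)
    moreover have "(\<Prod>i\<in>UNIV. real (k i choose \<alpha> i) / real (N choose \<alpha> i))
        = real (\<Prod>i\<in>UNIV. k i choose \<alpha> i) / real (\<Prod>i\<in>UNIV. N choose \<alpha> i)" for k
      by (simp add: prod_dividef)
    ultimately show ?thesis
      by (simp add: sum_divide_distrib[symmetric] nonzero_divide_eq_eq mult.commute del: of_nat_prod)
  qed
  have w_sum: "sum (w N) (K N) = 1" for N
    using exact[of "\<lambda>_. 0" N] L1 by simp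
  have ex_t: "\<exists>t. t \<in> {0..1} \<and> (k \<in> K N \<longrightarrow> \<phi> t = (\<chi> i. real (k i) / real N))" for N k
  proof (cases "k \<in> K N")
    case True
    then have "k i \<le> N" for i by (auto simp: K_def)
    then have "0 \<le> (\<chi> i. real (k i) / real N) $ i \<and> (\<chi> i. real (k i) / real N) $ i \<le> 1" for i
      by (cases "N = 0") auto
    then show ?thesis
      using \<phi>(4) by blast
  qed auto
  define t where "t N k = (SOME t. t \<in> {0..1} \<and> (k \<in> K N \<longrightarrow> \<phi> t = (\<chi> i. real (k i) / real N)))" for N k
  have t: "t N k \<in> {0..1}" "k \<in> K N \<Longrightarrow> \<phi> (t N k) = (\<chi> i. real (k i) / real N)" for N k
    using someI_ex[OF ex_t[of k N]] unfolding t_def[symmetric] by simp_all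
  \<comment> \<open>\<open>Suc m\<close> keeps the grid denominator positive.\<close>
  define \<nu> where "\<nu> m = distr (point_measure (K (Suc m)) (\<lambda>k. ennreal (w (Suc m) k))) borel (t (Suc m))" for m
  have real_distr: "real_distribution (\<nu> m)" for m
  proof -
    have "prob_space (point_measure (K (Suc m)) (\<lambda>k. ennreal (w (Suc m) k)))"
      by (intro prob_spaceI)
        (simp add: space_point_measure emeasure_point_measure_finite fin sum_ennreal w_nonneg w_sum)
    then have "prob_space (\<nu> m)"
      unfolding \<nu>_def by (rule prob_space.prob_space_distr) simp
    then show ?thesis
      by (simp add: real_distribution_def real_distribution_axioms_def \<nu>_def)
  qed
  have \<nu>_integral: "(\<integral>x. g x \<partial>\<nu> m) = (\<Sum>k\<in>K (Suc m). w (Suc m) k * g (t (Suc m) k))"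
    if "g \<in> borel_measurable borel" for g :: "real \<Rightarrow> real" and m
    unfolding \<nu>_def using that
    by (subst integral_distr) (simp_all add: lebesgue_integral_point_measure_finite fin w_nonneg)
  \<comment> \<open>All parameters lie in [0, 1]; tightness is stated with half-open intervals, so
    the left end is moved below 0.\<close>
  have "measure (\<nu> m) {-1<..1} = 1" for m
  proof -
    interpret \<nu>: real_distribution "\<nu> m" by (rule real_distr)
    have "measure (\<nu> m) {-1<..1} = (\<integral>x. indicator {-1<..1} x \<partial>\<nu> m)"
      by simp
    also have "\<dots> = (\<Sum>k\<in>K (Suc m). w (Suc m) k * indicator {-1<..1} (t (Suc m) k))"
      by (rule \<nu>_integral) simp
    also have "\<dots> = 1"
      using t(1) by (subst w_sum[of "Suc m", symmetric], intro sum.cong)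
        (auto simp: indicator_def less_le_trans[of "-1" 0])
    finally show ?thesis .
  qed
  then have "\<exists>a b. a < b \<and> (\<forall>m. 1 - \<epsilon> < measure (\<nu> m) {a<..b})" if "0 < \<epsilon>" for \<epsilon> :: real
    using that by (rule_tac exI[of _ "-1"], rule_tac exI[of _ 1]) simp
  then have "tight \<nu>"
    by (simp add: tight_def real_distr)
  then obtain r M where r: "strict_mono r" and M: "real_distribution M"
    and conv: "weak_conv_m (\<nu> \<circ> id \<circ> r) M"
    using tight_imp_convergent_subsubsequence[of \<nu> id] by (auto simp: strict_mono_def)
  interpret M: real_distribution M by (rule M)
  have \<phi>_meas [measurable]: "\<phi> \<in> borel_measurable borel"
    using \<phi>(1) by (rule borel_measurable_continuous_onI)
  define \<mu> where "\<mu> = distr M borel \<phi>"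
  have "prob_space \<mu>"
    unfolding \<mu>_def by (rule M.prob_space_distr) simp
  moreover have "sets \<mu> = sets borel" by (simp add: \<mu>_def)
  \<comment> \<open>Every value of the curve lies in the cube, so the image measure is supported
    there whatever \<open>M\<close> is.\<close>
  moreover have "AE x in \<mu>. \<forall>i. 0 \<le> x $ i \<and> x $ i \<le> 1"
    unfolding \<mu>_def by (subst AE_distr_iff) (auto simp: \<phi>)
  moreover have "(\<integral>x. (\<Prod>i\<in>UNIV. (x $ i) ^ \<alpha> i) \<partial>\<mu>) = L (\<Prod>i\<in>UNIV. u i ^ \<alpha> i)" for \<alpha>
  proof -
    let ?g = "\<lambda>t. \<Prod>i\<in>UNIV. (\<phi> t $ i) ^ \<alpha> i"
    have cont: "continuous_on UNIV ?g"
      using \<phi>(1) by (intro continuous_intros) auto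
    have bound: "norm (?g t) \<le> 1" for t
      using \<phi> by (simp add: abs_prod prod_le_1 power_abs power_le_one)
    have eq: "(\<integral>x. (\<Prod>i\<in>UNIV. (x $ i) ^ \<alpha> i) \<partial>\<mu>) = (\<integral>t. ?g t \<partial>M)"
      unfolding \<mu>_def by (subst integral_distr) auto
    have lim: "(\<lambda>j. \<integral>t. ?g t \<partial>(\<nu> \<circ> id \<circ> r) j) \<longlonglongrightarrow> (\<integral>t. ?g t \<partial>M)"
      using cont bound
      by (intro weak_conv_imp_integral_bdd_continuous_conv[OF _ M conv, where B = 1])
        (auto simp: real_distr continuous_on_eq_continuous_at)
    have lim': "(\<lambda>j. \<integral>t. ?g t \<partial>(\<nu> \<circ> id \<circ> r) j) \<longlonglongrightarrow> L (\<Prod>i\<in>UNIV. u i ^ \<alpha> i)"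
    proof -
      \<comment> \<open>Sums the bounds of \<open>choose_ratio_approx\<close> over the coordinates:
        all factors have absolute value at most 1, so the products differ by at most the sum of the
        factor differences.\<close>
      define C where "C = (\<Sum>i\<in>UNIV. real (\<alpha> i) * real (\<alpha> i))"
      have "\<bar>(\<integral>t. ?g t \<partial>\<nu> m) - L (\<Prod>i\<in>UNIV. u i ^ \<alpha> i)\<bar> \<le> C / real (Suc m)"
        if m: "(\<Sum>i\<in>UNIV. \<alpha> i) \<le> m" for m
      proof -
        let ?N = "Suc m"
        have \<alpha>: "\<alpha> i \<le> ?N" for i
          using member_le_sum[of i UNIV \<alpha>] m by simp
        let ?p = "\<lambda>k. \<Prod>i\<in>UNIV. (real (k i) / real ?N) ^ \<alpha> i"
        let ?q = "\<lambda>k. \<Prod>i\<in>UNIV. real (k i choose \<alpha> i) / real (?N choose \<alpha> i)"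
        have "(\<integral>t. ?g t \<partial>\<nu> m) = (\<Sum>k\<in>K ?N. w ?N k * ?p k)"
          using t(2) by (subst \<nu>_integral) (auto intro!: borel_measurable_continuous_onI cont sum.cong)
        then have "\<bar>(\<integral>t. ?g t \<partial>\<nu> m) - L (\<Prod>i\<in>UNIV. u i ^ \<alpha> i)\<bar>
            = \<bar>\<Sum>k\<in>K ?N. w ?N k * (?p k - ?q k)\<bar>"
          unfolding exact[OF \<alpha>, symmetric] by (simp add: right_diff_distrib sum_subtractf)
        also have "\<dots> \<le> (\<Sum>k\<in>K ?N. w ?N k * (C / real ?N))"
        proof (rule order_trans[OF sum_abs], rule sum_mono)
          fix k assume "k \<in> K ?N"
          then have k: "k i \<le> ?N" for i by (auto simp: K_def)
          have "\<bar>?p k - ?q k\<bar> \<le> (\<Sum>i\<in>UNIV. norm ((real (k i) / real ?N) ^ \<alpha> i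
              - real (k i choose \<alpha> i) / real (?N choose \<alpha> i)))"
            unfolding real_norm_def[symmetric]
          proof (rule norm_prod_diff)
            fix i
            show "norm ((real (k i) / real ?N) ^ \<alpha> i) \<le> 1"
              using k[of i] by (simp add: power_abs power_le_one divide_le_eq_1)
            show "norm (real (k i choose \<alpha> i) / real (?N choose \<alpha> i)) \<le> 1"
              using choose_ratio_le_1[OF k] by simp
          qed
          also have "\<dots> \<le> (\<Sum>i\<in>UNIV. real (\<alpha> i) * real (\<alpha> i) / real ?N)"
            using choose_ratio_approx[OF k \<alpha>] by (intro sum_mono) (simp add: abs_minus_commute)
          finally have "\<bar>?p k - ?q k\<bar> \<le> C / real ?N"
            by (simp add: C_def sum_divide_distrib)
          then show "\<bar>w ?N k * (?p k - ?q k)\<bar> \<le> w ?N k * (C / real ?N)"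
            unfolding abs_mult abs_of_nonneg[OF w_nonneg] by (rule mult_left_mono[OF _ w_nonneg])
        qed
        also have "\<dots> = C / real ?N"
          by (simp only: sum_distrib_right[symmetric] w_sum mult_1)
        finally show ?thesis .
      qed
      then have "\<forall>\<^sub>F m in sequentially. norm ((\<integral>t. ?g t \<partial>\<nu> m) - L (\<Prod>i\<in>UNIV. u i ^ \<alpha> i)) \<le> C / real (Suc m)"
        unfolding real_norm_def by (intro eventually_sequentiallyI[of "\<Sum>i\<in>UNIV. \<alpha> i"])
      moreover have "(\<lambda>m. C / real (Suc m)) \<longlonglongrightarrow> 0"
        using tendsto_mult_left[OF LIMSEQ_inverse_real_of_nat, of C] by (simp add: field_simps)
      ultimately have "(\<lambda>m. (\<integral>t. ?g t \<partial>\<nu> m) - L (\<Prod>i\<in>UNIV. u i ^ \<alpha> i)) \<longlonglongrightarrow> 0"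
        by (rule Lim_null_comparison)
      then have "(\<lambda>m. \<integral>t. ?g t \<partial>\<nu> m) \<longlonglongrightarrow> L (\<Prod>i\<in>UNIV. u i ^ \<alpha> i)"
        by (simp add: LIM_zero_iff)
      from LIMSEQ_subseq_LIMSEQ[OF this r] show ?thesis
        by (simp add: comp_def)
    qed
    show ?thesis
      unfolding eq by (rule LIMSEQ_unique[OF lim lim'])
  qed
  ultimately show ?thesis using that by blast
qed

section \<open>Polynomials\<close>

lemma Lfun_superset:
  assumes "finite A" "Poly_Mapping.keys p \<subseteq> A"
  shows "Lfun z p = (\<Sum>\<alpha>\<in>A. Poly_Mapping.lookup p \<alpha> * z \<alpha>)"
  unfolding Lfun_def using assms by (intro sum.mono_neutral_left) (auto simp: in_keys_iff)

lemma Lfun_cong: "(\<And>\<alpha>. \<alpha> \<in> Poly_Mapping.keys p \<Longrightarrow> y \<alpha> = z \<alpha>) \<Longrightarrow> Lfun y p = Lfun z p"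
  by (simp add: Lfun_def)

lemma Lfun_additive: "Modules.additive (Lfun z)"
proof
  fix p q :: "'a mpoly"
  let ?A = "Poly_Mapping.keys p \<union> Poly_Mapping.keys q"
  have "Lfun z r = (\<Sum>\<alpha>\<in>?A. Poly_Mapping.lookup r \<alpha> * z \<alpha>)" if "r \<in> {p, q, p + q}" for r
    using that keys_add[of p q] by (intro Lfun_superset) auto
  then show "Lfun z (p + q) = Lfun z p + Lfun z q"
    by (simp add: lookup_add distrib_right sum.distrib)
qed

lemmas Lfun_add = Modules.additive.add[OF Lfun_additive]
  and Lfun_diff = Modules.additive.diff[OF Lfun_additive]
  and Lfun_zero = Modules.additive.zero[OF Lfun_additive]
  and Lfun_sum = Modules.additive.sum[OF Lfun_additive]

lemma Lfun_single: "Lfun z (Poly_Mapping.single \<alpha> c) = c * z \<alpha>"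
  by (cases "c = 0") (simp_all add: Lfun_def)

lemma Lfun_monomial: "Lfun z (monomial \<alpha>) = z \<alpha>"
  by (simp add: monomial_def Lfun_single)

lemma mpoly_eq_sum_single:
  fixes p :: "'n::finite mpoly"
  assumes "finite A" "Poly_Mapping.keys p \<subseteq> A"
  shows "p = (\<Sum>\<alpha>\<in>A. Poly_Mapping.single \<alpha> (Poly_Mapping.lookup p \<alpha>))"
proof (rule poly_mapping_eqI)
  fix \<beta>
  have "(\<Sum>\<alpha>\<in>A. Poly_Mapping.lookup (Poly_Mapping.single \<alpha> (Poly_Mapping.lookup p \<alpha>)) \<beta>)
      = (\<Sum>\<alpha>\<in>A. if \<alpha> = \<beta> then Poly_Mapping.lookup p \<alpha> else 0)"
    by (intro sum.cong) (auto simp: lookup_single)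
  also have "\<dots> = Poly_Mapping.lookup p \<beta>"
    using assms by (auto simp: in_keys_iff)
  finally show "Poly_Mapping.lookup p \<beta> =
      Poly_Mapping.lookup (\<Sum>\<alpha>\<in>A. Poly_Mapping.single \<alpha> (Poly_Mapping.lookup p \<alpha>)) \<beta>"
    by (simp add: lookup_sum)
qed

lemma mpoly_induct [case_names single add]:
  fixes p :: "'n::finite mpoly"
  assumes single: "\<And>\<alpha> c. Q (Poly_Mapping.single \<alpha> c)"
    and add: "\<And>p q. Q p \<Longrightarrow> Q q \<Longrightarrow> Q (p + q)"
  shows "Q p"
proof -
  have *: "Q (\<Sum>\<alpha>\<in>A. Poly_Mapping.single \<alpha> (Poly_Mapping.lookup p \<alpha>))" if "finite A" for A
    using that by induction (use single[of 0 0] assms in auto)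
  show ?thesis
    by (subst mpoly_eq_sum_single[OF finite_keys order_refl, of p]) (rule *[OF finite_keys])
qed

lemma Lfun_const_mult: "Lfun z (Poly_Mapping.single 0 c * p) = c * Lfun z p"
  by (induction p rule: mpoly_induct)
    (simp_all add: mult_single Lfun_single distrib_left Lfun_add)

section \<open>Evaluation of polynomials at points\<close>

lemma peval_eq_Lfun: "peval p x = Lfun (\<lambda>\<alpha>. mono \<alpha> x) p"
  by (simp add: peval_def Lfun_def)

lemma mono_0: "mono 0 x = 1"
  by (simp add: mono_def)

lemma mono_add: "mono (\<alpha> + \<beta>) x = mono \<alpha> x * mono \<beta> x"
  by (simp add: mono_def lookup_add power_add prod.distrib)

lemma mono_single: "mono (Poly_Mapping.single i 1) x = x $ i"
proof -
  have "mono (Poly_Mapping.single i 1) x = (\<Prod>j\<in>UNIV. if j = i then x $ i else 1)"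
    unfolding mono_def by (intro prod.cong) (auto simp: lookup_single when_def)
  then show ?thesis by simp
qed

lemma peval_add: "peval (p + q) x = peval p x + peval q x"
  and peval_diff: "peval (p - q) x = peval p x - peval q x"
  by (simp_all add: peval_eq_Lfun Lfun_add Lfun_diff)

lemma peval_single: "peval (Poly_Mapping.single \<alpha> c) x = c * mono \<alpha> x"
  by (simp add: peval_eq_Lfun Lfun_single)

lemma peval_monomial: "peval (monomial \<alpha>) x = mono \<alpha> x"
  by (simp add: monomial_def peval_single)

lemma peval_Var: "peval (Var i) x = x $ i"
  by (simp add: Var_def peval_single mono_single[unfolded One_nat_def])

lemma peval_1: "peval 1 x = 1"
  using peval_single[of 0 1 x] by (simp add: mono_0)

lemma peval_mult: "peval (p * q) x = peval p x * peval q x"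
proof (induction p rule: mpoly_induct)
  case (single \<alpha> c)
  show ?case
    by (induction q rule: mpoly_induct)
      (simp_all add: mult_single peval_single mono_add distrib_left peval_add)
qed (simp add: peval_add distrib_right)

lemma peval_power: "peval (p ^ k) x = peval p x ^ k"
  by (induction k) (simp_all add: peval_1 peval_mult)

lemma peval_prod: "peval (prod g A) x = (\<Prod>i\<in>A. peval (g i) x)"
  by (induction A rule: infinite_finite_induct) (simp_all add: peval_1 peval_mult)

lemma continuous_on_peval [continuous_intros]:
  "continuous_on S f \<Longrightarrow> continuous_on S (\<lambda>x. peval p (f x))"
  unfolding peval_def mono_def by (intro continuous_intros) auto

section \<open>Degrees of exponents and polynomials\<close>

lemma tdeg_0: "tdeg 0 = 0"
  by (simp add: tdeg_def)

lemma tdeg_add: "tdeg (\<alpha> + \<beta>) = tdeg \<alpha> + tdeg \<beta>"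
  by (simp add: tdeg_def lookup_add sum.distrib)

lemma exponent_induct [case_names 0 add]:
  fixes \<alpha> :: "'n::finite \<Rightarrow>\<^sub>0 nat"
  assumes "Q 0" and step: "\<And>\<alpha> i. Q \<alpha> \<Longrightarrow> Q (\<alpha> + Poly_Mapping.single i 1)"
  shows "Q \<alpha>"
proof (induction "tdeg \<alpha>" arbitrary: \<alpha>)
  case 0
  then have "\<alpha> = 0"
    by (intro poly_mapping_eqI) (simp add: tdeg_def)
  then show ?case using assms by simp
next
  case (Suc k)
  then obtain i where i: "Poly_Mapping.lookup \<alpha> i \<noteq> 0"
    unfolding tdeg_def by (metis sum.neutral nat.distinct(1))
  let ?\<beta> = "Poly_Mapping.update i (Poly_Mapping.lookup \<alpha> i - 1) \<alpha>"
  have \<alpha>: "\<alpha> = ?\<beta> + Poly_Mapping.single i 1"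
    using i by (intro poly_mapping_eqI) (auto simp: lookup_add lookup_update lookup_single when_def)
  have "tdeg (Poly_Mapping.single i 1) = (\<Sum>j\<in>UNIV. if j = i then 1 else 0)"
    unfolding tdeg_def by (intro sum.cong) (auto simp: lookup_single when_def)
  then have "k = tdeg ?\<beta>"
    using Suc(2) tdeg_add[of ?\<beta> "Poly_Mapping.single i 1"] \<alpha> by simp
  from step[OF Suc(1)[OF this], of i] show ?case
    unfolding \<alpha>[symmetric] .
qed

lemma pdeg_le_iff: "pdeg p \<le> m \<longleftrightarrow> (\<forall>\<alpha>\<in>Poly_Mapping.keys p. tdeg \<alpha> \<le> m)"
  by (cases "p = 0") (auto simp: pdeg_def)

lemma tdeg_le_pdeg: "\<alpha> \<in> Poly_Mapping.keys p \<Longrightarrow> tdeg \<alpha> \<le> pdeg p"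
  using pdeg_le_iff by blast

lemma pdeg_1: "pdeg 1 = 0"
  using pdeg_le_iff[of 1 0] by (simp add: tdeg_0)

lemma pdeg_monomial: "pdeg (monomial \<alpha>) = tdeg \<alpha>"
proof -
  have "monomial \<alpha> \<noteq> 0"
    unfolding monomial_def by (metis lookup_single_eq lookup_zero zero_neq_one)
  then show ?thesis
    by (simp add: pdeg_def) (simp add: monomial_def)
qed

lemma pdeg_mult_le: "pdeg (p * q) \<le> pdeg p + pdeg q"
proof (unfold pdeg_le_iff, rule ballI)
  fix \<alpha> assume "\<alpha> \<in> Poly_Mapping.keys (p * q)"
  then obtain \<beta> \<gamma> where "\<alpha> = \<beta> + \<gamma>" "\<beta> \<in> Poly_Mapping.keys p" "\<gamma> \<in> Poly_Mapping.keys q"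
    using keys_mult[of p q] by blast
  then show "tdeg \<alpha> \<le> pdeg p + pdeg q"
    by (simp add: tdeg_add add_mono tdeg_le_pdeg)
qed

lemma pdeg_power_le: "pdeg (p ^ k) \<le> k * pdeg p"
proof (induction k)
  case (Suc k)
  then show ?case using pdeg_mult_le[of p "p ^ k"] by simp
qed (simp add: pdeg_1)

lemma pdeg_prod_le: "pdeg (prod g A) \<le> (\<Sum>i\<in>A. pdeg (g i))"
proof (induction A rule: infinite_finite_induct)
  case (insert i A)
  then show ?case using pdeg_mult_le[of "g i" "prod g A"] by simp
qed (simp_all add: pdeg_1)

lemma pdeg_diff_le: "pdeg p \<le> m \<Longrightarrow> pdeg q \<le> m \<Longrightarrow> pdeg (p - q) \<le> m"
  unfolding pdeg_le_iff by (metis diff_self in_keys_iff lookup_minus)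

text \<open>The composed part has degree at most \<open>d * tdeg \<alpha>\<close>; the subtracted
  monomial obeys the same bound because of \<open>1 \<le> d\<close>.\<close>

lemma pdeg_Apoly_le:
  assumes "\<And>i. pdeg (P i) \<le> d" "1 \<le> d"
  shows "pdeg (Apoly P \<alpha>) \<le> d * tdeg \<alpha>"
  unfolding Apoly_def
proof (rule pdeg_diff_le)
  have "pdeg (\<Prod>i\<in>UNIV. P i ^ Poly_Mapping.lookup \<alpha> i) \<le> (\<Sum>i\<in>UNIV. pdeg (P i ^ Poly_Mapping.lookup \<alpha> i))"
    by (rule pdeg_prod_le)
  also have "\<dots> \<le> (\<Sum>i\<in>UNIV. d * Poly_Mapping.lookup \<alpha> i)"
  proof (rule sum_mono)
    fix i
    have "pdeg (P i) * Poly_Mapping.lookup \<alpha> i \<le> d * Poly_Mapping.lookup \<alpha> i"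
      using assms(1) by (rule mult_le_mono1)
    then show "pdeg (P i ^ Poly_Mapping.lookup \<alpha> i) \<le> d * Poly_Mapping.lookup \<alpha> i"
      using pdeg_power_le[of "P i" "Poly_Mapping.lookup \<alpha> i"]
      by (metis le_trans mult.commute)
  qed
  finally show "pdeg (\<Prod>i\<in>UNIV. P i ^ Poly_Mapping.lookup \<alpha> i) \<le> d * tdeg \<alpha>"
    by (simp add: tdeg_def sum_distrib_left)
  show "pdeg (monomial \<alpha>) \<le> d * tdeg \<alpha>"
    using assms(2) by (simp add: pdeg_monomial)
qed

lemma inj_on_lookup: "inj_on Poly_Mapping.lookup A"
  by (rule inj_onI) (simp only: poly_mapping_eq_iff)

lemma finite_tdeg_le: "finite {\<alpha> :: 'n::finite \<Rightarrow>\<^sub>0 nat. tdeg \<alpha> \<le> m}"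
proof (rule finite_imageD)
  have "Poly_Mapping.lookup \<alpha> i \<le> m" if "tdeg \<alpha> \<le> m" for \<alpha> :: "'n \<Rightarrow>\<^sub>0 nat" and i
    using member_le_sum[of i UNIV "Poly_Mapping.lookup \<alpha>"] that by (simp add: tdeg_def)
  then have "Poly_Mapping.lookup ` {\<alpha> :: 'n \<Rightarrow>\<^sub>0 nat. tdeg \<alpha> \<le> m} \<subseteq> PiE UNIV (\<lambda>_. {..m})"
    by auto
  then show "finite (Poly_Mapping.lookup ` {\<alpha> :: 'n \<Rightarrow>\<^sub>0 nat. tdeg \<alpha> \<le> m})"
    by (rule finite_subset) (auto intro: finite_PiE)
qed (rule inj_on_lookup)

lemma finite_mm_index: "finite (mm_index l \<sigma>)"
  by (rule finite_subset[OF _ finite_tdeg_le[of "l"]]) (auto simp: mm_index_def)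

lemma countable_exponents: "countable (UNIV :: ('n::finite \<Rightarrow>\<^sub>0 nat) set)"
  by (rule countable_image_inj_on[OF countableI_type inj_on_lookup])

text \<open>Bilinearity: a vector \<open>v\<close> is the coefficient vector of a polynomial q, and
  the quadratic form of the localizing matrix at \<open>v\<close> is the functional at \<sigma>
  q^2.\<close>

lemma moment_form_eq:
  fixes v :: "('n::finite \<Rightarrow>\<^sub>0 nat) \<Rightarrow> real"
  assumes "finite A"
  shows "(\<Sum>\<beta>\<in>A. \<Sum>\<gamma>\<in>A. v \<beta> * v \<gamma> * Lfun y (\<sigma> * monomial \<beta> * monomial \<gamma>))
    = Lfun y (\<sigma> * (\<Sum>\<beta>\<in>A. Poly_Mapping.single \<beta> (v \<beta>)) * (\<Sum>\<beta>\<in>A. Poly_Mapping.single \<beta> (v \<beta>)))"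
proof -
  have single: "Poly_Mapping.single \<beta> (v \<beta>) = Poly_Mapping.single 0 (v \<beta>) * monomial \<beta>" for \<beta>
    by (simp add: monomial_def mult_single)
  have "\<sigma> * (\<Sum>\<beta>\<in>A. Poly_Mapping.single \<beta> (v \<beta>)) * (\<Sum>\<beta>\<in>A. Poly_Mapping.single \<beta> (v \<beta>))
      = (\<Sum>\<beta>\<in>A. \<Sum>\<gamma>\<in>A. \<sigma> * Poly_Mapping.single \<beta> (v \<beta>) * Poly_Mapping.single \<gamma> (v \<gamma>))"
    by (simp only: mult.assoc sum_product) (simp only: sum_distrib_left)
  also have "\<dots> = (\<Sum>\<beta>\<in>A. \<Sum>\<gamma>\<in>A. Poly_Mapping.single 0 (v \<beta>) *
      (Poly_Mapping.single 0 (v \<gamma>) * (\<sigma> * monomial \<beta> * monomial \<gamma>)))"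
    unfolding single by (intro sum.cong refl) (simp add: ac_simps)
  finally show ?thesis
    by (simp add: Lfun_sum Lfun_const_mult mult.assoc)
qed

text \<open>The degree bound puts all exponents of \<open>q\<close> into the index set of the
  matrix, so its coefficients are an admissible test vector. For fixed \<open>q\<close> the bound
  holds once \<open>l\<close> is large.\<close>

lemma moment_psd_square:
  fixes q :: "'n::finite mpoly"
  assumes "moment_psd l y \<sigma>" "pdeg \<sigma> + 2 * pdeg q \<le> l"
  shows "0 \<le> Lfun y (q * q * \<sigma>)"
proof -
  have "Poly_Mapping.keys q \<subseteq> mm_index l \<sigma>"
  proof
    fix \<alpha> assume "\<alpha> \<in> Poly_Mapping.keys q"
    then show "\<alpha> \<in> mm_index l \<sigma>"
      using tdeg_le_pdeg[of \<alpha> q] assms(2) by (simp add: mm_index_def)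
  qed
  from mpoly_eq_sum_single[OF finite_mm_index this, symmetric] show ?thesis
    using assms(1)[unfolded moment_psd_def, rule_format, of "Poly_Mapping.lookup q"]
    unfolding moment_form_eq[OF finite_mm_index] by (simp add: ac_simps)
qed

section \<open>Measures with compact support\<close>

lemma stone_weierstrass_mpoly:
  fixes f :: "real ^ 'n::finite \<Rightarrow> real"
  assumes "compact K" "continuous_on K f" "0 < e"
  obtains p where "\<And>x. x \<in> K \<Longrightarrow> \<bar>f x - peval p x\<bar> < e"
proof -
  have "\<exists>g. (\<exists>p. g = peval p) \<and> (\<forall>x\<in>K. \<bar>f x - g x\<bar> < e)"
  proof (rule Stone_Weierstrass_HOL[OF assms(1) _ _ _ _ _ assms(2,3)])
    fix c :: real
    show "\<exists>p. (\<lambda>x :: real ^ 'n. c) = peval p"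
      by (rule exI[of _ "Poly_Mapping.single 0 c"]) (simp add: fun_eq_iff peval_single mono_0)
  next
    fix f :: "real ^ 'n \<Rightarrow> real" assume "\<exists>p. f = peval p"
    then show "continuous_on K f"
      using continuous_on_peval[OF continuous_on_id] by auto
  next
    fix f g :: "real ^ 'n \<Rightarrow> real" assume "(\<exists>p. f = peval p) \<and> (\<exists>p. g = peval p)"
    then obtain p q where "f = peval p" "g = peval q" by blast
    then show "\<exists>p. (\<lambda>x. f x + g x) = peval p" "\<exists>p. (\<lambda>x. f x * g x) = peval p"
      by (auto simp: fun_eq_iff intro: exI[of _ "p + q"] exI[of _ "p * q"] peval_add[symmetric] peval_mult[symmetric])
  next
    fix x y :: "real ^ 'n" assume "x \<in> K \<and> y \<in> K \<and> x \<noteq> y"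
    then obtain i where "x $ i \<noteq> y $ i" by (auto simp: vec_eq_iff)
    then show "\<exists>f. (\<exists>p. f = peval p) \<and> f x \<noteq> f y"
      using peval_Var by metis
  qed
  then show ?thesis using that by auto
qed

lemma integrable_continuous_compact_support:
  fixes f :: "'a::euclidean_space \<Rightarrow> real"
  assumes "finite_measure \<mu>" "sets \<mu> = sets borel" "AE x in \<mu>. x \<in> K" "compact K"
    "continuous_on UNIV f"
  shows "integrable \<mu> f"
proof -
  have "compact (f ` K)"
    using assms by (intro compact_continuous_image continuous_on_subset[OF assms(5)]) auto
  then obtain B where B: "\<And>x. x \<in> K \<Longrightarrow> norm (f x) \<le> B"
    by (metis compact_imp_bounded bounded_iff imageI)
  have "f \<in> borel_measurable \<mu>"
    using borel_measurable_continuous_onI[OF assms(5)] measurable_cong_sets[OF assms(2) refl] by blast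
  then show ?thesis
    using B assms(3) by (intro finite_measure.integrable_const_bound[OF assms(1), of f B]) auto
qed

lemma integral_peval_eq_Lfun:
  assumes "\<And>\<alpha>. integrable \<mu> (mono \<alpha>)"
  shows "(\<integral>x. peval p x \<partial>\<mu>) = Lfun (moment \<mu>) p"
  unfolding peval_def Lfun_def moment_def using assms by simp

text \<open>Stone-Weierstrass extends equality from polynomials to continuous functions, cut-off
  functions of the distance extend it to closed sets, and these form an intersection-stable
  generator of the Borel sets.\<close>

lemma measure_eq_of_moments:
  fixes \<mu> \<nu> :: "(real ^ 'n::finite) measure"
  assumes \<mu>: "finite_measure \<mu>" "sets \<mu> = sets borel" "AE x in \<mu>. x \<in> K"
    and \<nu>: "finite_measure \<nu>" "sets \<nu> = sets borel" "AE x in \<nu>. x \<in> K"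
    and K: "compact K"
    and eq: "\<And>p. (\<integral>x. peval p x \<partial>\<mu>) = (\<integral>x. peval p x \<partial>\<nu>)"
  shows "\<mu> = \<nu>"
proof -
  interpret \<mu>: finite_measure \<mu> by fact
  interpret \<nu>: finite_measure \<nu> by fact
  have space: "space \<mu> = UNIV" "space \<nu> = UNIV"
    using sets_eq_imp_space_eq[OF \<mu>(2)] sets_eq_imp_space_eq[OF \<nu>(2)] by simp_all
  have approx: "\<bar>(\<integral>x. f x \<partial>M) - (\<integral>x. peval p x \<partial>M)\<bar> \<le> e * measure M UNIV"
    if M: "finite_measure M" "sets M = sets borel" "AE x in M. x \<in> K"
      and f: "continuous_on UNIV f" and p: "\<And>x. x \<in> K \<Longrightarrow> \<bar>f x - peval p x\<bar> < e" for M f p e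
  proof -
    interpret M: finite_measure M by fact
    have cp: "continuous_on UNIV (peval p)" by (intro continuous_on_peval continuous_on_id)
    have "\<bar>(\<integral>x. f x \<partial>M) - (\<integral>x. peval p x \<partial>M)\<bar> = \<bar>\<integral>x. f x - peval p x \<partial>M\<bar>"
      using integrable_continuous_compact_support[OF M K] f cp by simp
    also have "\<dots> \<le> (\<integral>x. \<bar>f x - peval p x\<bar> \<partial>M)"
      by (rule integral_abs_bound)
    also have "\<dots> \<le> (\<integral>x. e \<partial>M)"
    proof (rule integral_mono_AE)
      show "integrable M (\<lambda>x. \<bar>f x - peval p x\<bar>)"
        using integrable_continuous_compact_support[OF M K] f cp by simp
      show "AE x in M. \<bar>f x - peval p x\<bar> \<le> e"
        using M(3) by eventually_elim (use p in \<open>auto intro: less_imp_le\<close>)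
    qed simp
    finally show ?thesis
      using sets_eq_imp_space_eq[OF M(2)] by (simp add: mult.commute)
  qed
  have cont: "(\<integral>x. f x \<partial>\<mu>) = (\<integral>x. f x \<partial>\<nu>)" if f: "continuous_on UNIV f" for f :: "real ^ 'n \<Rightarrow> real"
  proof -
    let ?C = "measure \<mu> UNIV + measure \<nu> UNIV"
    have "\<bar>(\<integral>x. f x \<partial>\<mu>) - (\<integral>x. f x \<partial>\<nu>)\<bar> \<le> 0 + e" if "0 < e" for e
    proof -
      \<comment> \<open>The measures are merely finite and may both vanish; adding 1 keeps the
        divisor positive.\<close>
      have pos: "0 < ?C + 1" by (simp add: add_nonneg_pos)
      obtain p where p: "\<And>x. x \<in> K \<Longrightarrow> \<bar>f x - peval p x\<bar> < e / (?C + 1)"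
        using stone_weierstrass_mpoly[OF K continuous_on_subset[OF f], of "e / (?C + 1)"] \<open>0 < e\<close> pos
        by auto
      have "\<bar>(\<integral>x. f x \<partial>\<mu>) - (\<integral>x. f x \<partial>\<nu>)\<bar> \<le> e / (?C + 1) * measure \<mu> UNIV + e / (?C + 1) * measure \<nu> UNIV"
        using approx[OF \<mu> f p] approx[OF \<nu> f p] unfolding eq by linarith
      also have "\<dots> = e * (?C / (?C + 1))"
        by (simp add: add_divide_distrib distrib_left)
      also have "\<dots> \<le> e"
        using \<open>0 < e\<close> pos by (intro mult_left_le) auto
      finally show ?thesis by simp
    qed
    then have "\<bar>(\<integral>x. f x \<partial>\<mu>) - (\<integral>x. f x \<partial>\<nu>)\<bar> \<le> 0"
      by (rule field_le_epsilon)
    then show ?thesis by simp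
  qed
  \<comment> \<open>\<open>infdist\<close> to the empty set is 0 by convention, so the cut-offs
    would be constantly 1 there; the empty set is treated separately at the end.\<close>
  have closed: "measure \<mu> C = measure \<nu> C" if C: "closed C" "C \<noteq> {}" for C
  proof -
    define g where "g m x = max 0 (1 - real m * infdist x C)" for m x
    have g_cont: "continuous_on UNIV (g m)" for m
      unfolding g_def by (intro continuous_intros)
    have g_lim: "(\<lambda>m. g m x) \<longlonglongrightarrow> indicator C x" for x
    proof (cases "x \<in> C")
      case True
      then show ?thesis by (simp add: g_def)
    next
      case False
      then have pos: "0 < infdist x C"
        using C infdist_pos_not_in_closed by blast
      then obtain N where N: "1 < real N * infdist x C"
        using reals_Archimedean3 by blast
      have "g m x = 0" if "N \<le> m" for m
      proof -
        have "real N * infdist x C \<le> real m * infdist x C"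
          using that pos by (intro mult_right_mono) auto
        then show ?thesis
          unfolding g_def using N by (intro max_absorb1) linarith
      qed
      then show ?thesis
        using False by (intro tendsto_eventually eventually_sequentiallyI[of N]) simp
    qed
    have lim: "(\<lambda>m. \<integral>x. g m x \<partial>M) \<longlonglongrightarrow> measure M C" if M: "finite_measure M" "sets M = sets borel" for M
    proof -
      interpret M: finite_measure M by fact
      have meas: "g m \<in> borel_measurable M" for m
        using borel_measurable_continuous_onI[OF g_cont] measurable_cong_sets[OF M(2) refl] by blast
      have "(\<lambda>m. \<integral>x. g m x \<partial>M) \<longlonglongrightarrow> (\<integral>x. indicator C x \<partial>M)"
      proof (rule integral_dominated_convergence[where w = "\<lambda>_. 1"])
        show "AE x in M. norm (g m x) \<le> 1" for m
          by (simp add: g_def infdist_nonneg)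
        show "indicator C \<in> borel_measurable M"
          using C M(2) by (intro borel_measurable_indicator) (simp add: borel_closed)
      qed (simp_all add: g_lim meas)
      then show ?thesis
        using sets_eq_imp_space_eq[OF M(2)] by simp
    qed
    show ?thesis
      using LIMSEQ_unique[OF lim[OF \<mu>(1,2)]] lim[OF \<nu>(1,2)] cont[OF g_cont] by simp
  qed
  show ?thesis
  proof (rule measure_eqI_generator_eq[where E = "Collect closed" and \<Omega> = UNIV and A = "\<lambda>_. UNIV"])
    show "Int_stable (Collect closed :: (real ^ 'n) set set)"
      by (auto simp: Int_stable_def)
    show "sets \<mu> = sigma_sets UNIV (Collect closed)" "sets \<nu> = sigma_sets UNIV (Collect closed)"
      by (simp_all add: \<mu> \<nu> borel_eq_closed)
    show "emeasure \<mu> C = emeasure \<nu> C" if "C \<in> Collect closed" for C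
      using closed[of C] that by (cases "C = {}") (simp_all add: \<mu>.emeasure_eq_measure \<nu>.emeasure_eq_measure)
  qed (auto simp: \<mu>.emeasure_eq_measure)
qed

text \<open>With s the negative part of \<sigma> and g its root, g^2 \<sigma> = -s^2. Testing with
  polynomials close to g thus bounds the integral of s^2 by arbitrarily small numbers, so s vanishes
  almost everywhere.\<close>

lemma AE_nonneg_of_square_multiples:
  fixes \<mu> :: "(real ^ 'n::finite) measure"
  assumes \<mu>: "finite_measure \<mu>" "sets \<mu> = sets borel" "AE x in \<mu>. x \<in> K" and K: "compact K"
    and nonneg: "\<And>q. 0 \<le> (\<integral>x. peval (q * q * \<sigma>) x \<partial>\<mu>)"
  shows "AE x in \<mu>. 0 \<le> peval \<sigma> x"
proof -
  interpret \<mu>: finite_measure \<mu> by fact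
  note int = integrable_continuous_compact_support[OF \<mu> K]
  have [continuous_intros]: "continuous_on UNIV (peval p)" for p :: "'n mpoly"
    by (intro continuous_on_peval continuous_on_id)
  define s where "s x = max 0 (- peval \<sigma> x)" for x
  define g where "g x = sqrt (s x)" for x
  have s_cont: "continuous_on UNIV s" and g_cont: "continuous_on UNIV g"
    unfolding g_def s_def by (intro continuous_intros)+
  have s_nonneg: "0 \<le> s x" for x by (simp add: s_def)
  have g_sq: "g x * g x * peval \<sigma> x = - (s x * s x)" for x
    by (auto simp: g_def s_def max_def)
  have bdd: "\<exists>B>0. \<forall>x\<in>K. \<bar>h x\<bar> \<le> B" if "continuous_on UNIV h" for h :: "real ^ 'n \<Rightarrow> real"
  proof -
    have "bounded (h ` K)"
      using K that by (intro compact_imp_bounded compact_continuous_image continuous_on_subset[OF that]) auto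
    then show ?thesis
      unfolding bounded_pos by auto
  qed
  obtain G where G: "0 < G" "\<And>x. x \<in> K \<Longrightarrow> \<bar>g x\<bar> \<le> G" using bdd[OF g_cont] by blast
  obtain S where S: "0 < S" "\<And>x. x \<in> K \<Longrightarrow> \<bar>peval \<sigma> x\<bar> \<le> S"
    using bdd[of "peval \<sigma>"] continuous_on_peval[OF continuous_on_id] by blast
  \<comment> \<open>On \<open>K\<close>, s^2 + q^2 \<sigma> = (q - g)(q + g) \<sigma>. The factors
    are bounded by e, by 2G + 1 (as |q| < G + e and e < 1), and by S.\<close>
  let ?C = "(2 * G + 1) * S * measure \<mu> (space \<mu>)"
  have bound: "(\<integral>x. s x * s x \<partial>\<mu>) \<le> e * ?C" if e: "0 < e" "e < 1" for e
  proof -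
    obtain q where q: "\<And>x. x \<in> K \<Longrightarrow> \<bar>g x - peval q x\<bar> < e"
      using stone_weierstrass_mpoly[OF K continuous_on_subset[OF g_cont subset_UNIV] e(1)] by blast
    have "(\<integral>x. s x * s x \<partial>\<mu>) \<le> (\<integral>x. s x * s x \<partial>\<mu>) + (\<integral>x. peval (q * q * \<sigma>) x \<partial>\<mu>)"
      using nonneg by simp
    also have "\<dots> = (\<integral>x. s x * s x + peval (q * q * \<sigma>) x \<partial>\<mu>)"
      by (intro Bochner_Integration.integral_add[symmetric] int continuous_intros s_cont)
    also have "\<dots> \<le> (\<integral>x. e * ((2 * G + 1) * S) \<partial>\<mu>)"
    proof (rule integral_mono_AE)
      show "integrable \<mu> (\<lambda>x. s x * s x + peval (q * q * \<sigma>) x)"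
        by (intro int continuous_intros s_cont)
      show "AE x in \<mu>. s x * s x + peval (q * q * \<sigma>) x \<le> e * ((2 * G + 1) * S)"
        using \<mu>(3)
      proof eventually_elim
        fix x assume x: "x \<in> K"
        have "s x * s x + peval (q * q * \<sigma>) x = (peval q x - g x) * (peval q x + g x) * peval \<sigma> x"
          using g_sq[of x] by (simp add: peval_mult algebra_simps)
        also have "\<dots> \<le> \<bar>peval q x - g x\<bar> * \<bar>peval q x + g x\<bar> * \<bar>peval \<sigma> x\<bar>"
          by (metis abs_ge_self abs_mult)
        also have "\<dots> \<le> e * (2 * G + 1) * S"
          using q[OF x] G(2)[OF x] S x e G(1) by (intro mult_mono) auto
        finally show "s x * s x + peval (q * q * \<sigma>) x \<le> e * ((2 * G + 1) * S)"
          by (simp add: mult.assoc)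
      qed
    qed simp
    finally show ?thesis by (simp add: algebra_simps)
  qed
  \<comment> \<open>The double successor keeps the chosen error strictly below 1, as
    \<open>bound\<close> requires.\<close>
  have "(\<lambda>m. inverse (real (Suc (Suc m))) * ?C) \<longlonglongrightarrow> 0 * ?C"
    by (intro tendsto_mult tendsto_const LIMSEQ_Suc[OF LIMSEQ_inverse_real_of_nat])
  then have "(\<integral>x. s x * s x \<partial>\<mu>) \<le> 0 * ?C"
  proof (rule LIMSEQ_le_const)
    show "\<exists>N. \<forall>m\<ge>N. (\<integral>x. s x * s x \<partial>\<mu>) \<le> inverse (real (Suc (Suc m))) * ?C"
      by (intro exI allI impI bound) (auto simp: inverse_eq_divide)
  qed
  then have "(\<integral>x. s x * s x \<partial>\<mu>) = 0"
    by (intro antisym) (simp_all add: s_nonneg)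
  then have "AE x in \<mu>. s x * s x = 0"
    using integral_nonneg_eq_0_iff_AE[of \<mu> "\<lambda>x. s x * s x"]
    by (simp add: s_nonneg int s_cont continuous_on_mult)
  then show ?thesis
    by eventually_elim (auto simp: s_def max_def split: if_splits)
qed

lemma representing_measure_box:
  fixes z :: "('n::finite \<Rightarrow>\<^sub>0 nat) \<Rightarrow> real"
  assumes z0: "z 0 = 1" and 1: "1 \<in> nonneg_mult (Lfun z)" and c: "0 < c"
    and box: "\<And>i. Poly_Mapping.single 0 (c * c) - Var i * Var i \<in> nonneg_mult (Lfun z)"
  obtains \<mu> :: "(real ^ 'n) measure" and K where "prob_space \<mu>" "sets \<mu> = sets borel" "compact K"
    "AE x in \<mu>. x \<in> K" "\<And>\<alpha>. moment \<mu> \<alpha> = z \<alpha>"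
proof -
  let ?k = "Poly_Mapping.single 0 (1 / (2 * c)) :: 'n mpoly" and ?c = "Poly_Mapping.single 0 c :: 'n mpoly"
  have scale: "Poly_Mapping.single 0 t * p \<in> nonneg_mult (Lfun z)"
    if "0 \<le> t" "p \<in> nonneg_mult (Lfun z)" for t p
    using that by (simp add: nonneg_mult_def mult.left_commute[of _ "Poly_Mapping.single 0 t"] Lfun_const_mult)
  have two_c: "Poly_Mapping.single 0 (2 * c) = 2 * ?c"
    by (simp only: mult_2 single_add)
  have kc: "?k * (2 * ?c) = 1"
    using c by (simp add: mult_single flip: two_c)
  \<comment> \<open>The affine map from [-c, c] onto [0, 1], namely (c + x_i) / (2c).\<close>
  define u where "u i = ?k * (?c + Var i)" for i
  \<comment> \<open>From 2c (c + s) = (c + s)^2 + (c^2 - s^2). Taking s as either sign of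
    \<open>Var i\<close> covers both \<open>u i\<close> and \<open>1 - u i\<close>.\<close>
  have lin: "?c + s \<in> nonneg_mult (Lfun z)" if s: "s * s = Var i * Var i" for s i
  proof -
    have "?k * ((?c + s) * (?c + s) * 1 + (?c * ?c - s * s)) = (?k * (2 * ?c)) * (?c + s)"
      by (simp add: algebra_simps)
    then have eq: "?c + s = ?k * ((?c + s) * (?c + s) * 1 + (?c * ?c - s * s))"
      by (simp only: kc mult_1)
    have "?c * ?c - s * s \<in> nonneg_mult (Lfun z)"
      using box[of i] by (simp add: s mult_single)
    then show ?thesis
      using c by (subst eq) (intro scale nonneg_mult_add[OF Lfun_additive] nonneg_mult_square 1; simp)
  qed
  have u1: "u i \<in> nonneg_mult (Lfun z)" for i
    unfolding u_def using c by (intro scale lin[OF refl]) auto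
  have u2: "1 - u i \<in> nonneg_mult (Lfun z)" for i
  proof -
    have "1 - u i = ?k * (?c + - Var i)"
      unfolding u_def by (subst kc[symmetric]) (simp add: algebra_simps)
    then show ?thesis using c by (simp only:) (intro scale lin[of _ i]; simp)
  qed
  have "Lfun z 1 = 1"
    using Lfun_single[of z 0 1] z0 by simp
  then obtain \<mu>0 :: "(real ^ 'n) measure" where \<mu>0: "prob_space \<mu>0" "sets \<mu>0 = sets borel"
    "AE x in \<mu>0. \<forall>i. 0 \<le> x $ i \<and> x $ i \<le> 1"
    "\<And>\<alpha>. (\<integral>x. (\<Prod>i\<in>UNIV. (x $ i) ^ \<alpha> i) \<partial>\<mu>0) = Lfun z (\<Prod>i\<in>UNIV. u i ^ \<alpha> i)"
    by (rule hausdorff_moment_problem[where u = u, OF Lfun_additive _ 1 u1 u2]) (rule that)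
  interpret \<mu>0: prob_space \<mu>0 by fact
  have supp: "AE x in \<mu>0. x \<in> cbox 0 1"
    using \<mu>0(3) by eventually_elim (auto simp: mem_box_cart)
  note int = integrable_continuous_compact_support[OF \<mu>0.finite_measure_axioms \<mu>0(2) supp compact_cbox]
  define h :: "real ^ 'n \<Rightarrow> real ^ 'n" where "h x = (\<chi> i. 2 * c * x $ i - c)" for x
  have h_cont: "continuous_on S h" for S
    unfolding h_def by (intro continuous_intros)
  have h_meas: "h \<in> borel_measurable \<mu>0"
    using borel_measurable_continuous_onI[OF h_cont] measurable_cong_sets[OF \<mu>0(2) refl] by blast
  define T where "T \<beta> \<alpha> x = mono \<beta> (h x) * (\<Prod>i\<in>UNIV. (x $ i) ^ \<alpha> i)" for \<beta> and \<alpha> :: "'n \<Rightarrow> nat" and x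
  have T_int: "integrable \<mu>0 (T \<beta> \<alpha>)" for \<beta> \<alpha>
    unfolding T_def mono_def h_def by (intro int continuous_intros)
  \<comment> \<open>Monomials in the variables must be expressed through those in the
    \<open>u i\<close>. The mixed form, with \<alpha> generalized, trades one variable at a time by
    x_i = 2c u_i - c; \<alpha> = 0 gives the moments.\<close>
  have key: "Lfun z (monomial \<beta> * (\<Prod>i\<in>UNIV. u i ^ \<alpha> i)) = (\<integral>x. T \<beta> \<alpha> x \<partial>\<mu>0)" for \<beta> \<alpha>
  proof (induction \<beta> arbitrary: \<alpha> rule: exponent_induct)
    case 0
    show ?case
      using \<mu>0(4)[of \<alpha>] by (simp add: T_def mono_0 monomial_def)
  next
    case (add \<beta> i)
    have upd: "(\<Prod>j\<in>UNIV. f j ^ (\<alpha>(i := Suc (\<alpha> i))) j) = f i * (\<Prod>j\<in>UNIV. f j ^ \<alpha> j)"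
      for f :: "'n \<Rightarrow> 'b::comm_monoid_mult"
    proof -
      have "(\<Prod>j\<in>UNIV. f j ^ (\<alpha>(i := Suc (\<alpha> i))) j) = (\<Prod>j\<in>UNIV. (if j = i then f j else 1) * f j ^ \<alpha> j)"
        by (intro prod.cong) auto
      then show ?thesis by (simp add: prod.distrib)
    qed
    have Var: "Var i = 2 * ?c * u i - ?c"
    proof -
      have "2 * ?c * u i = (?k * (2 * ?c)) * (?c + Var i)"
        unfolding u_def by (simp only: ac_simps)
      then show ?thesis by (simp add: kc)
    qed
    have "monomial (\<beta> + Poly_Mapping.single i 1) * (\<Prod>j\<in>UNIV. u j ^ \<alpha> j)
        = monomial \<beta> * Var i * (\<Prod>j\<in>UNIV. u j ^ \<alpha> j)"
      by (simp add: monomial_def Var_def mult_single)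
    also have "\<dots> = Poly_Mapping.single 0 (2 * c) * (monomial \<beta> * (\<Prod>j\<in>UNIV. u j ^ (\<alpha>(i := Suc (\<alpha> i))) j))
        - ?c * (monomial \<beta> * (\<Prod>j\<in>UNIV. u j ^ \<alpha> j))"
      unfolding Var upd two_c by (simp add: algebra_simps)
    finally have "Lfun z (monomial (\<beta> + Poly_Mapping.single i 1) * (\<Prod>j\<in>UNIV. u j ^ \<alpha> j))
        = 2 * c * (\<integral>x. T \<beta> (\<alpha>(i := Suc (\<alpha> i))) x \<partial>\<mu>0) - c * (\<integral>x. T \<beta> \<alpha> x \<partial>\<mu>0)"
      by (simp only: Lfun_diff Lfun_const_mult add)
    also have "\<dots> = (\<integral>x. 2 * c * T \<beta> (\<alpha>(i := Suc (\<alpha> i))) x - c * T \<beta> \<alpha> x \<partial>\<mu>0)"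
      using T_int by simp
    also have "\<dots> = (\<integral>x. T (\<beta> + Poly_Mapping.single i 1) \<alpha> x \<partial>\<mu>0)"
      unfolding T_def upd mono_add mono_single by (simp add: h_def algebra_simps)
    finally show ?case .
  qed
  define \<mu> where "\<mu> = distr \<mu>0 borel h"
  have "prob_space \<mu>"
    unfolding \<mu>_def by (rule \<mu>0.prob_space_distr[OF h_meas])
  moreover have "AE x in \<mu>. x \<in> h ` cbox 0 1"
  proof -
    have "compact (h ` cbox 0 1)"
      by (intro compact_continuous_image h_cont compact_cbox)
    then have "h ` cbox 0 1 \<in> sets borel"
      by (intro borel_closed compact_imp_closed)
    then show ?thesis
      unfolding \<mu>_def by (subst AE_distr_iff[OF h_meas]) (use supp in auto)
  qed
  moreover have "moment \<mu> \<alpha> = z \<alpha>" for \<alpha>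
  proof -
    have "mono \<alpha> \<in> borel_measurable borel"
      unfolding mono_def by (intro borel_measurable_continuous_onI continuous_intros)
    then have "moment \<mu> \<alpha> = (\<integral>x. mono \<alpha> (h x) \<partial>\<mu>0)"
      unfolding moment_def \<mu>_def by (intro integral_distr h_meas)
    also have "\<dots> = z \<alpha>"
      using key[of \<alpha> "\<lambda>_. 0"] by (simp add: T_def Lfun_monomial)
    finally show ?thesis .
  qed
  ultimately show ?thesis
    using that[of \<mu> "h ` cbox 0 1"] compact_continuous_image[OF h_cont compact_cbox] by (simp add: \<mu>_def)
qed

section \<open>Convergence of the relaxations\<close>

text \<open>The complement of \<open>X\<close> is null and \<open>f\<close> maps \<open>X\<close>
  into itself, so preimages may be taken in the whole space. Invariance becomes an equality of two
  measures, which moments can decide.\<close>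

lemma invariant_prob_iff_distr:
  fixes X :: "(real ^ 'n::finite) set"
  assumes X: "X \<in> sets borel" and f: "f \<in> borel_measurable borel" and maps: "\<And>x. x \<in> X \<Longrightarrow> f x \<in> X"
  shows "invariant_prob X f \<mu> \<longleftrightarrow>
    sets \<mu> = sets borel \<and> prob_space \<mu> \<and> (AE x in \<mu>. x \<in> X) \<and> distr \<mu> borel f = \<mu>"
proof (cases "sets \<mu> = sets borel \<and> prob_space \<mu>")
  case True
  then interpret prob_space \<mu> by simp
  have sets: "sets \<mu> = sets borel" using True by simp
  have space: "space \<mu> = UNIV" using sets_eq_imp_space_eq[OF sets] by simp
  have f': "f \<in> measurable \<mu> borel"
    using f measurable_cong_sets[OF sets refl] by blast
  have vimage: "f -` A \<in> sets borel" if "A \<in> sets borel" for A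
    using measurable_sets[OF f that] by simp
  have X1: "emeasure \<mu> X = 1 \<longleftrightarrow> (AE x in \<mu>. x \<in> X)"
    using X sets by (simp add: AE_in_set_eq_1 emeasure_eq_measure)
  have Int_X: "emeasure \<mu> (A \<inter> X) = emeasure \<mu> A" if "A \<in> sets borel" "AE x in \<mu>. x \<in> X" for A
    using that X sets by (intro emeasure_eq_AE) auto
  have "(\<forall>A\<in>sets borel. A \<subseteq> X \<longrightarrow> emeasure \<mu> (f -` A \<inter> X) = emeasure \<mu> A) \<longleftrightarrow> distr \<mu> borel f = \<mu>"
    (is "?L \<longleftrightarrow> ?R") if AE: "AE x in \<mu>. x \<in> X"
  proof
    assume L: ?L
    show ?R
    proof (rule measure_eqI)
      fix A assume "A \<in> sets (distr \<mu> borel f)"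
      then have A: "A \<in> sets borel" by simp
      have "emeasure (distr \<mu> borel f) A = emeasure \<mu> (f -` A \<inter> X)"
        using A AE by (simp add: emeasure_distr[OF f'] space Int_X vimage)
      also have "f -` A \<inter> X = f -` (A \<inter> X) \<inter> X"
        using maps by auto
      also have "emeasure \<mu> \<dots> = emeasure \<mu> (A \<inter> X)"
        using L A X by auto
      finally show "emeasure (distr \<mu> borel f) A = emeasure \<mu> A"
        using A AE by (simp add: Int_X)
    qed (simp add: sets)
  next
    assume R: ?R
    show ?L
    proof (intro ballI impI)
      fix A :: "(real ^ 'n) set" assume A: "A \<in> sets borel"
      have "emeasure \<mu> (f -` A \<inter> X) = emeasure (distr \<mu> borel f) A"
        using A AE by (simp add: emeasure_distr[OF f'] space Int_X vimage)
      then show "emeasure \<mu> (f -` A \<inter> X) = emeasure \<mu> A"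
        by (simp add: R)
    qed
  qed
  then show ?thesis
    using True X1 by (auto simp: invariant_prob_def)
qed (auto simp: invariant_prob_def)

text \<open>The counterpart of \<open>nonneg_mult\<close> before a limit functional exists: the
  threshold may depend on \<open>q\<close>. The Archimedean certificate is exploited at this level,
  because the boundedness it yields precedes the choice of a convergent subsequence.\<close>

definition eventually_nonneg :: "(nat \<Rightarrow> ('n::finite \<Rightarrow>\<^sub>0 nat) \<Rightarrow> real) \<Rightarrow> 'n mpoly set" where
  "eventually_nonneg y = {p. \<forall>q. \<forall>\<^sub>F k in sequentially. 0 \<le> Lfun (y k) (q * q * p)}"

lemma eventually_nonneg_add:
  assumes "p \<in> eventually_nonneg y" "q \<in> eventually_nonneg y"
  shows "p + q \<in> eventually_nonneg y"
  unfolding eventually_nonneg_def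
proof (intro CollectI allI)
  fix r
  have "\<forall>\<^sub>F k in sequentially. 0 \<le> Lfun (y k) (r * r * p)" "\<forall>\<^sub>F k in sequentially. 0 \<le> Lfun (y k) (r * r * q)"
    using assms by (auto simp: eventually_nonneg_def)
  then show "\<forall>\<^sub>F k in sequentially. 0 \<le> Lfun (y k) (r * r * (p + q))"
    by eventually_elim (simp add: distrib_left Lfun_add)
qed

lemma eventually_nonneg_0: "0 \<in> eventually_nonneg y"
  by (simp add: eventually_nonneg_def Lfun_zero)

lemma eventually_nonneg_sum:
  "(\<And>i. i \<in> A \<Longrightarrow> g i \<in> eventually_nonneg y) \<Longrightarrow> sum g A \<in> eventually_nonneg y"
  by (induction A rule: infinite_finite_induct) (simp_all add: eventually_nonneg_0 eventually_nonneg_add)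

lemma eventually_nonneg_square:
  assumes "p \<in> eventually_nonneg y"
  shows "q * q * p \<in> eventually_nonneg y"
  unfolding eventually_nonneg_def
proof (intro CollectI allI)
  fix r
  have "\<forall>\<^sub>F k in sequentially. 0 \<le> Lfun (y k) ((r * q) * (r * q) * p)"
    using assms by (simp add: eventually_nonneg_def)
  then show "\<forall>\<^sub>F k in sequentially. 0 \<le> Lfun (y k) (r * r * (q * q * p))"
    by (simp only: ac_simps)
qed

lemma eventually_nonneg_const:
  assumes "0 \<le> c" "1 \<in> eventually_nonneg y"
  shows "Poly_Mapping.single 0 c \<in> eventually_nonneg y"
proof -
  have "Poly_Mapping.single 0 (sqrt c) * Poly_Mapping.single 0 (sqrt c) * 1 \<in> eventually_nonneg y"
    using assms(2) by (rule eventually_nonneg_square)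
  then show ?thesis using assms(1) by (simp add: mult_single)
qed

lemma eventually_nonneg_sos:
  assumes "is_sos s" "p \<in> eventually_nonneg y"
  shows "s * p \<in> eventually_nonneg y"
proof -
  obtain qs where s: "s = sum_list (map (\<lambda>q. q * q) qs)"
    using assms(1) by (auto simp: is_sos_def)
  show ?thesis
    unfolding s
  proof (induction qs)
    case (Cons q qs)
    then show ?case
      using eventually_nonneg_square[OF assms(2), of q] by (simp add: distrib_right eventually_nonneg_add)
  qed (simp add: eventually_nonneg_0)
qed

lemma tendsto_Lfun:
  "(\<And>\<alpha>. ((\<lambda>j. y j \<alpha>) \<longlongrightarrow> z \<alpha>) G) \<Longrightarrow> ((\<lambda>j. Lfun (y j) p) \<longlongrightarrow> Lfun z p) G"
  unfolding Lfun_def by (intro tendsto_intros)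

lemma eventually_nonneg_limit:
  assumes "p \<in> eventually_nonneg y" "strict_mono r" "\<And>\<alpha>. (\<lambda>j. y (r j) \<alpha>) \<longlonglongrightarrow> z \<alpha>"
  shows "p \<in> nonneg_mult (Lfun z)"
  unfolding nonneg_mult_def
proof (intro CollectI allI)
  fix q
  have "\<forall>\<^sub>F k in sequentially. 0 \<le> Lfun (y k) (q * q * p)"
    using assms(1) by (simp add: eventually_nonneg_def)
  then have "\<forall>\<^sub>F j in sequentially. 0 \<le> Lfun (y (r j)) (q * q * p)"
    using filterlim_subseq[OF assms(2)] by (auto simp: filterlim_iff)
  then show "0 \<le> Lfun z (q * q * p)"
    using tendsto_lowerbound[OF tendsto_Lfun[of "\<lambda>j. y (r j)", OF assms(3)]] by simp
qed

text \<open>The Archimedean certificate, multiplied by squares, bounds even moments recursively.\<close>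
lemma moments_bounded:
  fixes y :: "nat \<Rightarrow> ('n::finite \<Rightarrow>\<^sub>0 nat) \<Rightarrow> real"
  assumes 1: "1 \<in> eventually_nonneg y" and y0: "\<And>k. y k 0 = 1"
    and box: "\<And>i. Poly_Mapping.single 0 c - Var i * Var i \<in> eventually_nonneg y" and c: "0 \<le> c"
  shows "Bseq (\<lambda>k. y k \<alpha>)"
proof -
  have "\<exists>B. \<forall>\<^sub>F k in sequentially. Lfun (y k) (monomial \<alpha> * monomial \<alpha>) \<le> B"
  proof (induction \<alpha> rule: exponent_induct)
    case 0
    show ?case
      by (rule exI[of _ 1]) (simp add: monomial_def Lfun_single mult_single y0 del: single_one)
  next
    case (add \<alpha> i)
    then obtain B where "\<forall>\<^sub>F k in sequentially. Lfun (y k) (monomial \<alpha> * monomial \<alpha>) \<le> B"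
      by blast
    moreover have "\<forall>\<^sub>F k in sequentially. 0 \<le> Lfun (y k) (monomial \<alpha> * monomial \<alpha> * (Poly_Mapping.single 0 c - Var i * Var i))"
      using box[of i] by (simp add: eventually_nonneg_def)
    ultimately have "\<forall>\<^sub>F k in sequentially.
      Lfun (y k) (monomial (\<alpha> + Poly_Mapping.single i 1) * monomial (\<alpha> + Poly_Mapping.single i 1)) \<le> c * B"
    proof eventually_elim
      case (elim k)
      have "monomial (\<alpha> + Poly_Mapping.single i 1) = monomial \<alpha> * Var i"
        by (simp add: monomial_def Var_def mult_single)
      then have "monomial \<alpha> * monomial \<alpha> * (Poly_Mapping.single 0 c - Var i * Var i)
        = Poly_Mapping.single 0 c * (monomial \<alpha> * monomial \<alpha>)
          - monomial (\<alpha> + Poly_Mapping.single i 1) * monomial (\<alpha> + Poly_Mapping.single i 1)"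
        by (simp add: algebra_simps)
      then have "Lfun (y k) (monomial (\<alpha> + Poly_Mapping.single i 1) * monomial (\<alpha> + Poly_Mapping.single i 1))
          \<le> c * Lfun (y k) (monomial \<alpha> * monomial \<alpha>)"
        using elim(2) by (simp only: Lfun_diff Lfun_const_mult)
      also have "\<dots> \<le> c * B"
        using elim(1) c by (rule mult_left_mono)
      finally show ?case .
    qed
    then show ?case by blast
  qed
  then obtain B where "\<forall>\<^sub>F k in sequentially. Lfun (y k) (monomial \<alpha> * monomial \<alpha>) \<le> B"
    by blast
  \<comment> \<open>An arbitrary moment is controlled by the even one: the squares of 1 + x^\<alpha>
    and 1 - x^\<alpha> give 2 |y_\<alpha>| <= 1 + L(x^(2\<alpha>)).\<close>
  moreover have "\<forall>\<^sub>F k in sequentially. 0 \<le> Lfun (y k) ((1 + monomial \<alpha>) * (1 + monomial \<alpha>) * 1)"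
    "\<forall>\<^sub>F k in sequentially. 0 \<le> Lfun (y k) ((1 - monomial \<alpha>) * (1 - monomial \<alpha>) * 1)"
    using 1 unfolding eventually_nonneg_def by blast+
  ultimately have "\<forall>\<^sub>F k in sequentially. norm (y k \<alpha>) \<le> (1 + B) / 2"
  proof eventually_elim
    case (elim k)
    have L1: "Lfun (y k) 1 = 1"
      using Lfun_single[of "y k" 0 1] by (simp add: y0)
    have "(1 + monomial \<alpha>) * (1 + monomial \<alpha>) * 1 = 1 + (monomial \<alpha> + monomial \<alpha>) + monomial \<alpha> * monomial \<alpha>"
      "(1 - monomial \<alpha>) * (1 - monomial \<alpha>) * 1 = 1 - (monomial \<alpha> + monomial \<alpha>) + monomial \<alpha> * monomial \<alpha>"
      by (simp_all add: algebra_simps)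
    then have "0 \<le> 1 + 2 * y k \<alpha> + Lfun (y k) (monomial \<alpha> * monomial \<alpha>)"
      "0 \<le> 1 - 2 * y k \<alpha> + Lfun (y k) (monomial \<alpha> * monomial \<alpha>)"
      using elim(2,3) by (simp_all only: Lfun_add Lfun_diff Lfun_monomial L1)
    then show ?case
      using elim(1) by (simp add: abs_le_iff)
  qed
  then show ?thesis
    by (rule BfunI)
qed

lemma diagonal_convergent_subsequence:
  fixes y :: "nat \<Rightarrow> 'a \<Rightarrow> real"
  assumes "countable (UNIV :: 'a set)" "\<And>\<alpha>. Bseq (\<lambda>k. y k \<alpha>)"
  obtains r z where "strict_mono r" "\<And>\<alpha>. (\<lambda>j. y (r j) \<alpha>) \<longlonglongrightarrow> z \<alpha>"
proof -
  define e where "e = from_nat_into (UNIV :: 'a set)"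
  have "range e = UNIV"
    unfolding e_def using assms(1) by (intro range_from_nat_into) auto
  interpret subseqs "\<lambda>n s. convergent (\<lambda>j. y (s j) (e n))"
  proof
    fix n and s :: "nat \<Rightarrow> nat" assume "strict_mono s"
    have "Bseq ((\<lambda>k. y k (e n)) \<circ> s)"
      unfolding comp_def using Bseq_subseq[OF assms(2)] by simp
    then have "bounded (range ((\<lambda>k. y k (e n)) \<circ> s))"
      by (simp add: Bseq_eq_bounded)
    then show "\<exists>r. strict_mono r \<and> convergent (\<lambda>j. y ((s \<circ> r) j) (e n))"
      using bounded_imp_convergent_subsequence by (fastforce simp: convergent_def comp_def)
  qed
  have "convergent (\<lambda>j. y ((diagseq \<circ> (+) (Suc n)) j) (e n))" for n
  proof (rule diagseq_holds)
    fix r s :: "nat \<Rightarrow> nat" and n assume "strict_mono r" "convergent (\<lambda>j. y (s j) (e n))"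
    then show "convergent (\<lambda>j. y ((s \<circ> r) j) (e n))"
      using convergent_subseq_convergent[of "\<lambda>j. y (s j) (e n)" r] by (simp add: comp_def)
  qed
  \<comment> \<open>The diagonal is a subsequence of the n-th selection only from index
    \<open>Suc n\<close> on; the initial terms do not affect convergence.\<close>
  then have "convergent (\<lambda>j. y (diagseq (j + Suc n)) (e n))" for n
    unfolding comp_def by (subst add.commute)
  then have "convergent (\<lambda>j. y (diagseq j) (e n))" for n
    using convergent_ignore_initial_segment[of "\<lambda>j. y (diagseq j) (e n)" "Suc n"] by blast
  then have "convergent (\<lambda>j. y (diagseq j) \<alpha>)" for \<alpha>
    using \<open>range e = UNIV\<close> by (metis surjD)
  then have "(\<lambda>j. y (diagseq j) \<alpha>) \<longlonglongrightarrow> lim (\<lambda>j. y (diagseq j) \<alpha>)" for \<alpha>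
    using convergent_LIMSEQ_iff by blast
  then show ?thesis
    by (rule that[OF subseq_diagseq])
qed

section \<open>Feasibility of truncated moment vectors of invariant measures\<close>

lemma moment_psd_of_measure:
  fixes \<nu> :: "(real ^ 'n::finite) measure"
  assumes int: "\<And>p. integrable \<nu> (peval p)" and nonneg: "AE x in \<nu>. 0 \<le> peval \<sigma> x"
    and z: "\<And>\<alpha>. tdeg \<alpha> \<le> l \<Longrightarrow> z \<alpha> = moment \<nu> \<alpha>"
  shows "moment_psd l z \<sigma>"
proof -
  have mono: "integrable \<nu> (mono \<alpha>)" for \<alpha>
    using int[of "monomial \<alpha>"] by (simp add: peval_monomial[abs_def])
  \<comment> \<open>The localizing matrix involves entries of degree at most \<open>l\<close> alone,
    so truncating the moments leaves it unchanged.\<close>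
  have eq: "Lfun z (\<sigma> * monomial \<beta> * monomial \<gamma>) = Lfun (moment \<nu>) (\<sigma> * monomial \<beta> * monomial \<gamma>)"
    if "\<beta> \<in> mm_index l \<sigma>" "\<gamma> \<in> mm_index l \<sigma>" for \<beta> \<gamma>
  proof (rule Lfun_cong, rule z)
    fix \<alpha> assume "\<alpha> \<in> Poly_Mapping.keys (\<sigma> * monomial \<beta> * monomial \<gamma>)"
    then have "tdeg \<alpha> \<le> pdeg (\<sigma> * monomial \<beta> * monomial \<gamma>)"
      by (rule tdeg_le_pdeg)
    also have "\<dots> \<le> pdeg \<sigma> + tdeg \<beta> + tdeg \<gamma>"
      using pdeg_mult_le[of "\<sigma> * monomial \<beta>" "monomial \<gamma>"] pdeg_mult_le[of \<sigma> "monomial \<beta>"]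
      by (simp add: pdeg_monomial)
    also have "\<dots> \<le> l"
      using that by (simp add: mm_index_def)
    finally show "tdeg \<alpha> \<le> l" .
  qed
  show ?thesis
    unfolding moment_psd_def
  proof
    fix v :: "('n \<Rightarrow>\<^sub>0 nat) \<Rightarrow> real"
    let ?A = "mm_index l \<sigma>"
    let ?q = "\<Sum>\<beta>\<in>?A. Poly_Mapping.single \<beta> (v \<beta>)"
    have "(\<Sum>\<beta>\<in>?A. \<Sum>\<gamma>\<in>?A. v \<beta> * v \<gamma> * Lfun z (\<sigma> * monomial \<beta> * monomial \<gamma>))
        = (\<integral>x. peval (\<sigma> * ?q * ?q) x \<partial>\<nu>)"
      unfolding integral_peval_eq_Lfun[OF mono] moment_form_eq[OF finite_mm_index, symmetric]
      by (intro sum.cong refl) (simp add: eq)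
    also have "0 \<le> \<dots>"
      using nonneg by (intro integral_nonneg_AE) (auto simp: peval_mult mult.assoc)
    finally show "0 \<le> (\<Sum>\<beta>\<in>?A. \<Sum>\<gamma>\<in>?A. v \<beta> * v \<gamma> * Lfun z (\<sigma> * monomial \<beta> * monomial \<gamma>))" .
  qed
qed

lemma mono_Pmap: "mono \<alpha> (Pmap P x) = peval (Apoly P \<alpha>) x + mono \<alpha> x"
  by (simp add: mono_def Apoly_def Pmap_def peval_diff peval_prod peval_power peval_monomial)

lemma invariant_prob_sdp_feasible:
  fixes \<sigma> :: "nat \<Rightarrow> 'n::finite mpoly"
  assumes X: "compact (semialg \<sigma> J)" and f_deg: "\<And>i. pdeg (P i) \<le> d" and "1 \<le> d" "d * k \<le> l"
    and maps: "\<And>x. x \<in> semialg \<sigma> J \<Longrightarrow> Pmap P x \<in> semialg \<sigma> J"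
    and inv: "invariant_prob (semialg \<sigma> J) (Pmap P) \<nu>"
  shows "sdp_feasible \<sigma> J P k l (\<lambda>\<alpha>. if tdeg \<alpha> \<le> l then moment \<nu> \<alpha> else 0)"
proof -
  have f: "Pmap P \<in> borel_measurable borel"
    unfolding Pmap_def by (intro borel_measurable_continuous_onI continuous_intros)
  have "semialg \<sigma> J \<in> sets borel"
    using X by (intro borel_closed compact_imp_closed)
  note * = iffD1[OF invariant_prob_iff_distr[OF this f maps] inv]
  then interpret prob_space \<nu> by simp
  have sets: "sets \<nu> = sets borel" and AE: "AE x in \<nu>. x \<in> semialg \<sigma> J" and distr: "distr \<nu> borel (Pmap P) = \<nu>"
    using * by auto
  have int: "integrable \<nu> (peval p)" for p
    by (intro integrable_continuous_compact_support[OF finite_measure_axioms sets AE X] continuous_intros)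
  have mono_int: "integrable \<nu> (mono \<alpha>)" for \<alpha>
    using int[of "monomial \<alpha>"] by (simp add: peval_monomial[abs_def])
  let ?z = "\<lambda>\<alpha>. if tdeg \<alpha> \<le> l then moment \<nu> \<alpha> else 0"
  have "Lfun ?z (Apoly P \<alpha>) = 0" if \<alpha>: "tdeg \<alpha> \<le> k" for \<alpha>
  proof -
    have "Lfun ?z (Apoly P \<alpha>) = Lfun (moment \<nu>) (Apoly P \<alpha>)"
    proof (rule Lfun_cong)
      fix \<beta> assume "\<beta> \<in> Poly_Mapping.keys (Apoly P \<alpha>)"
      then have "tdeg \<beta> \<le> d * tdeg \<alpha>"
        using tdeg_le_pdeg pdeg_Apoly_le[of P d \<alpha>] f_deg \<open>1 \<le> d\<close> le_trans by blast
      also have "\<dots> \<le> l"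
        using \<alpha> \<open>d * k \<le> l\<close> by (meson le_trans mult_le_mono2)
      finally show "?z \<beta> = moment \<nu> \<beta>" by simp
    qed
    also have "\<dots> = (\<integral>x. mono \<alpha> (Pmap P x) - mono \<alpha> x \<partial>\<nu>)"
      unfolding integral_peval_eq_Lfun[OF mono_int, symmetric] mono_Pmap by simp
    also have "\<dots> = (\<integral>x. mono \<alpha> (Pmap P x) \<partial>\<nu>) - (\<integral>x. mono \<alpha> x \<partial>\<nu>)"
      using int mono_int by (intro Bochner_Integration.integral_diff) (simp_all add: mono_Pmap)
    also have "(\<integral>x. mono \<alpha> (Pmap P x) \<partial>\<nu>) = (\<integral>x. mono \<alpha> x \<partial>distr \<nu> borel (Pmap P))"
    proof (rule integral_distr[symmetric])
      show "Pmap P \<in> measurable \<nu> borel"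
        using f measurable_cong_sets[OF sets refl] by blast
      show "mono \<alpha> \<in> borel_measurable borel"
        unfolding mono_def by (intro borel_measurable_continuous_onI continuous_intros)
    qed
    finally show ?thesis by (simp add: distr)
  qed
  moreover have "?z 0 = 1"
    using prob_space by (simp add: tdeg_0 moment_def mono_0)
  moreover have "moment_psd l ?z 1"
    by (rule moment_psd_of_measure[OF int]) (simp_all add: peval_1)
  moreover have "moment_psd l ?z (\<sigma> j)" if "j \<in> {1..J}" for j
  proof (rule moment_psd_of_measure[OF int])
    show "AE x in \<nu>. 0 \<le> peval (\<sigma> j) x"
      using AE by eventually_elim (use that in \<open>simp add: semialg_def\<close>)
  qed simp
  ultimately show ?thesis
    by (simp add: sdp_feasible_def)
qed

text \<open>With \<open>d = 0\<close> every constraint would be constant, so a nonempty feasible set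
  would be the whole space, which is not compact. Positivity of \<open>d\<close> is what makes
  \<open>d * k\<close>, and with it the relaxation order, grow with \<open>k\<close>.\<close>

lemma degree_pos:
  fixes \<sigma> :: "nat \<Rightarrow> 'n::finite mpoly"
  assumes X: "compact (semialg \<sigma> J)" "semialg \<sigma> J \<noteq> {}" and deg: "\<And>j. j \<in> {1..J} \<Longrightarrow> pdeg (\<sigma> j) \<le> d"
  shows "1 \<le> d"
proof (rule ccontr)
  assume "\<not> 1 \<le> d"
  have const: "peval (\<sigma> j) x = Poly_Mapping.lookup (\<sigma> j) 0" if "j \<in> {1..J}" for j x
  proof -
    have "Poly_Mapping.keys (\<sigma> j) \<subseteq> {0}"
    proof
      fix \<alpha> assume "\<alpha> \<in> Poly_Mapping.keys (\<sigma> j)"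
      then have "tdeg \<alpha> = 0"
        using tdeg_le_pdeg[of \<alpha>] deg[OF that] \<open>\<not> 1 \<le> d\<close> by fastforce
      then have "\<alpha> = 0"
        by (intro poly_mapping_eqI) (simp add: tdeg_def)
      then show "\<alpha> \<in> {0}" by simp
    qed
    then show ?thesis
      unfolding peval_eq_Lfun by (subst Lfun_superset[of "{0}"]) (simp_all add: mono_0)
  qed
  obtain x0 where x0: "\<forall>j\<in>{1..J}. 0 \<le> peval (\<sigma> j) x0"
    using X(2) by (auto simp: semialg_def)
  have "0 \<le> peval (\<sigma> j) x" if "j \<in> {1..J}" for j x
    using bspec[OF x0 that] const[OF that] by simp
  then have "semialg \<sigma> J = UNIV"
    unfolding semialg_def by blast
  then show False
    using X(1) compact_imp_bounded not_bounded_UNIV by metis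
qed

text \<open>Minimizers among invariant measures need not be unique; the measure produced is the one
  represented by the subsequential limit of the relaxations, and its optimality is proved
  afresh.\<close>

theorem theorem4p1:
  fixes \<sigma> :: "nat \<Rightarrow> 'n::finite mpoly" and J d :: nat
    and P :: "'n \<Rightarrow> 'n mpoly"
    and F :: "(('n \<Rightarrow>\<^sub>0 nat) \<Rightarrow> real) \<Rightarrow> real"
    and l :: "nat \<Rightarrow> nat"
    and y :: "nat \<Rightarrow> ('n \<Rightarrow>\<^sub>0 nat) \<Rightarrow> real"
  assumes X_compact: "compact (semialg \<sigma> J)"
    and sigma_deg: "\<forall>j\<in>{1..J}. pdeg (\<sigma> j) \<le> d"
    and archimedean: "\<exists>R::int. \<exists>s. (\<forall>j\<in>{0..J}. is_sos (s j)) \<and>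
        (of_int R)^2 - (\<Sum>i\<in>UNIV. Var i * Var i) = s 0 + (\<Sum>j=1..J. s j * \<sigma> j)"
    and f_deg: "\<forall>i. pdeg (P i) \<le> d"
    and f_maps: "\<forall>x\<in>semialg \<sigma> J. Pmap P x \<in> semialg \<sigma> J"
    and F_convex: "convex_fun F"
    and F_lsc: "lsc_fun d F"
    and F_dep: "depends_upto d F"
    and l_ge: "\<forall>k. d * k \<le> l k"
    and y_opt: "\<forall>k. sdp_feasible \<sigma> J P k (l k) (y k) \<and>
        (\<forall>z. sdp_feasible \<sigma> J P k (l k) z \<longrightarrow> F (y k) \<le> F z)"
    and mu_opt: "\<exists>\<mu>. optimal_inv (semialg \<sigma> J) (Pmap P) F \<mu>"
  shows "\<exists>\<mu>. optimal_inv (semialg \<sigma> J) (Pmap P) F \<mu> \<and>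
    (\<exists>r. strict_mono r \<and> (\<forall>\<alpha>. (\<lambda>j. y (r j) \<alpha>) \<longlonglongrightarrow> moment \<mu> \<alpha>))"
proof -
  let ?X = "semialg \<sigma> J" and ?f = "Pmap P"
  have maps: "x \<in> ?X \<Longrightarrow> ?f x \<in> ?X" for x
    using f_maps by blast
  have X_borel: "?X \<in> sets borel"
    using X_compact by (intro borel_closed compact_imp_closed)
  have f_meas: "?f \<in> borel_measurable borel"
    unfolding Pmap_def by (intro borel_measurable_continuous_onI continuous_intros)
  \<comment> \<open>A probability measure giving \<open>?X\<close> mass 1 excludes the empty set, as
    \<open>degree_pos\<close> requires.\<close>
  have "?X \<noteq> {}"
    using mu_opt by (auto simp: optimal_inv_def invariant_prob_def)
  then have d: "1 \<le> d"
    using degree_pos[OF X_compact] sigma_deg by blast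
  have l_ge': "k \<le> l k" for k
    using l_ge[rule_format, of k] d by (metis le_trans mult_le_mono1 nat_mult_1)
  have feas: "sdp_feasible \<sigma> J P k (l k) (y k)" for k
    using y_opt by blast
  have psd: "p \<in> eventually_nonneg y" if "\<And>k. moment_psd (l k) (y k) p" for p
    unfolding eventually_nonneg_def
  proof (intro CollectI allI)
    fix q
    show "\<forall>\<^sub>F k in sequentially. 0 \<le> Lfun (y k) (q * q * p)"
      using moment_psd_square[OF that] le_trans[OF _ l_ge']
      by (intro eventually_sequentiallyI[of "pdeg p + 2 * pdeg q"]) blast
  qed
  have E1: "1 \<in> eventually_nonneg y" and E\<sigma>: "\<And>j. j \<in> {1..J} \<Longrightarrow> \<sigma> j \<in> eventually_nonneg y"
    using feas by (auto intro!: psd simp: sdp_feasible_def)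
  have y0: "y k 0 = 1" for k
    using feas by (simp add: sdp_feasible_def)
  obtain R :: int and s where s: "\<And>j. j \<in> {0..J} \<Longrightarrow> is_sos (s j)"
    and cert: "(of_int R)^2 - (\<Sum>i\<in>UNIV. Var i * Var i) = s 0 + (\<Sum>j=1..J. s j * \<sigma> j)"
    using archimedean by blast
  \<comment> \<open>\<open>R\<close> may be zero or negative. This choice makes \<open>c\<close>
    positive, so that division by 2c is possible, and keeps c^2 >= R^2.\<close>
  define c where "c = \<bar>real_of_int R\<bar> + 1"
  have c: "0 < c" by (simp add: c_def)
  \<comment> \<open>Uses c^2 - x_i^2 = (R^2 - |x|^2) + (sum of x_j^2 over j different from i) + (c^2
    - R^2). The factors 1 give the summands the shape of a square times a multiplier.\<close>
  have box: "Poly_Mapping.single 0 (c * c) - Var i * Var i \<in> eventually_nonneg y" for i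
  proof -
    have "s 0 * 1 + (\<Sum>j=1..J. s j * \<sigma> j) \<in> eventually_nonneg y"
      by (intro eventually_nonneg_add eventually_nonneg_sum eventually_nonneg_sos s E1 E\<sigma>) auto
    then have "(of_int R)^2 - (\<Sum>i\<in>UNIV. Var i * Var i) \<in> eventually_nonneg y"
      by (simp add: cert)
    moreover have "(\<Sum>j\<in>UNIV - {i}. Var j * Var j * 1) \<in> eventually_nonneg y"
      by (intro eventually_nonneg_sum eventually_nonneg_square E1)
    moreover have "Poly_Mapping.single 0 (c * c - (of_int R)^2) \<in> eventually_nonneg y"
    proof (rule eventually_nonneg_const[OF _ E1])
      have "\<bar>real_of_int R\<bar>^2 \<le> c^2"
        unfolding c_def by (intro power_mono) auto
      then show "0 \<le> c * c - (of_int R)^2"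
        by (simp add: power2_eq_square)
    qed
    ultimately have "(of_int R)^2 - (\<Sum>i\<in>UNIV. Var i * Var i) + (\<Sum>j\<in>UNIV - {i}. Var j * Var j * 1)
        + Poly_Mapping.single 0 (c * c - (of_int R)^2) \<in> eventually_nonneg y"
      by (intro eventually_nonneg_add)
    moreover have const: "Poly_Mapping.single 0 (c * c - (of_int R)^2) = Poly_Mapping.single 0 (c * c) - (of_int R)^2"
      using single_of_int[of "R^2"] by (simp add: single_diff)
    have "(of_int R)^2 - (\<Sum>i\<in>UNIV. Var i * Var i) + (\<Sum>j\<in>UNIV - {i}. Var j * Var j * 1)
        + Poly_Mapping.single 0 (c * c - (of_int R)^2) = Poly_Mapping.single 0 (c * c) - Var i * Var i"
      unfolding const by (simp add: sum.remove[of UNIV i] algebra_simps)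
    ultimately show ?thesis
      by (simp only:)
  qed
  have bdd: "Bseq (\<lambda>k. y k \<alpha>)" for \<alpha>
    using c by (intro moments_bounded[OF E1 y0 box]) simp
  obtain r z where r: "strict_mono r" and z: "\<And>\<alpha>. (\<lambda>j. y (r j) \<alpha>) \<longlonglongrightarrow> z \<alpha>"
    by (rule diagonal_convergent_subsequence[where y = y, OF countable_exponents bdd]) (rule that)
  have limit: "p \<in> eventually_nonneg y \<Longrightarrow> p \<in> nonneg_mult (Lfun z)" for p
    by (rule eventually_nonneg_limit[OF _ r z])
  have z0: "z 0 = 1"
    using z[of 0] by (simp add: y0 LIMSEQ_const_iff)
  obtain \<mu> K where \<mu>: "prob_space \<mu>" "sets \<mu> = sets borel" "compact K" "AE x in \<mu>. x \<in> K"
    and moment: "\<And>\<alpha>. moment \<mu> \<alpha> = z \<alpha>"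
    by (rule representing_measure_box[OF z0 limit[OF E1] c limit[OF box]]) (rule that)
  interpret \<mu>: prob_space \<mu> by fact
  have moment_\<mu>: "moment \<mu> = z"
    using moment by blast
  have int: "integrable \<mu> (peval p)" for p
    by (intro integrable_continuous_compact_support[OF \<mu>.finite_measure_axioms \<mu>(2,4,3)] continuous_intros)
  have mono_int: "integrable \<mu> (mono \<alpha>)" for \<alpha>
    using int[of "monomial \<alpha>"] by (simp add: peval_monomial[abs_def])
  have repr: "(\<integral>x. peval p x \<partial>\<mu>) = Lfun z p" for p
    unfolding integral_peval_eq_Lfun[OF mono_int] moment_\<mu> ..
  have AE_X: "AE x in \<mu>. x \<in> ?X"
  proof -
    have "AE x in \<mu>. 0 \<le> peval (\<sigma> j) x" if "j \<in> {1..J}" for j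
      using nonneg_multD[OF limit[OF E\<sigma>[OF that]]]
      by (intro AE_nonneg_of_square_multiples[OF \<mu>.finite_measure_axioms \<mu>(2,4,3)]) (simp add: repr)
    then have "AE x in \<mu>. \<forall>j\<in>{1..J}. 0 \<le> peval (\<sigma> j) x"
      by (intro AE_finite_allI) auto
    then show ?thesis
      by (simp add: semialg_def)
  qed
  have f_meas': "?f \<in> measurable \<mu> borel"
    using f_meas measurable_cong_sets[OF \<mu>(2) refl] by blast
  have "distr \<mu> borel ?f = \<mu>"
  proof (rule measure_eq_of_moments[OF _ _ _ \<mu>.finite_measure_axioms \<mu>(2) AE_X X_compact])
    show "finite_measure (distr \<mu> borel ?f)"
      by (rule \<mu>.finite_measure_distr[OF f_meas'])
    show "AE x in distr \<mu> borel ?f. x \<in> ?X"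
      using X_borel by (subst AE_distr_iff[OF f_meas']) (use AE_X maps in auto)
    fix p
    \<comment> \<open>For fixed \<alpha> the row of the linear constraint is present as soon as
      \<open>r j\<close> reaches \<open>tdeg \<alpha>\<close>, so it survives in the limit.\<close>
    have inv: "(\<integral>x. mono \<alpha> (?f x) \<partial>\<mu>) = z \<alpha>" for \<alpha>
    proof -
      have "\<forall>\<^sub>F j in sequentially. Lfun (y (r j)) (Apoly P \<alpha>) = 0"
        using feas le_trans[OF _ seq_suble[OF r]] unfolding sdp_feasible_def
        by (intro eventually_sequentiallyI[of "tdeg \<alpha>"]) blast
      then have "(\<lambda>j. Lfun (y (r j)) (Apoly P \<alpha>)) \<longlonglongrightarrow> 0"
        by (rule tendsto_eventually)
      then have "Lfun z (Apoly P \<alpha>) = 0"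
        using LIMSEQ_unique tendsto_Lfun[of "\<lambda>j. y (r j)", OF z] by blast
      then show ?thesis
        using int mono_int repr[of "Apoly P \<alpha>"] moment[of \<alpha>] by (simp add: mono_Pmap moment_def)
    qed
    have "(\<integral>x. peval p x \<partial>distr \<mu> borel ?f) = (\<integral>x. peval p (?f x) \<partial>\<mu>)"
      by (intro integral_distr f_meas' borel_measurable_continuous_onI continuous_intros)
    also have "\<dots> = Lfun z p"
      using int mono_int by (simp add: peval_def Lfun_def mono_Pmap flip: inv)
    finally show "(\<integral>x. peval p x \<partial>distr \<mu> borel ?f) = (\<integral>x. peval p x \<partial>\<mu>)"
      by (simp add: repr)
  qed simp
  then have inv: "invariant_prob ?X ?f \<mu>"
    using \<mu> AE_X by (intro iffD2[OF invariant_prob_iff_distr[OF X_borel f_meas maps]]) simp_all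
  have "F (moment \<mu>) \<le> F (moment \<nu>)" if \<nu>: "invariant_prob ?X ?f \<nu>" for \<nu>
  proof -
    \<comment> \<open>\<open>1 \<le> k\<close> gives d <= d k <= l k, so truncation at
      \<open>l k\<close> keeps every entry on which \<open>F\<close> depends.\<close>
    have le: "F (y k) \<le> F (moment \<nu>)" if "1 \<le> k" for k
    proof -
      let ?z = "\<lambda>\<alpha>. if tdeg \<alpha> \<le> l k then moment \<nu> \<alpha> else 0"
      have "sdp_feasible \<sigma> J P k (l k) ?z"
        using f_deg l_ge by (intro invariant_prob_sdp_feasible[OF X_compact _ d _ maps \<nu>]) auto
      then have "F (y k) \<le> F ?z"
        using y_opt by blast
      moreover have "d \<le> l k"
        using l_ge[rule_format, of k] that by (metis le_trans mult_le_mono2 mult.right_neutral)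
      then have "F ?z = F (moment \<nu>)"
        by (intro F_dep[unfolded depends_upto_def, rule_format]) auto
      ultimately show ?thesis by simp
    qed
    have "ereal (F (moment \<mu>)) \<le> liminf (\<lambda>j. ereal (F (y (r j))))"
      unfolding moment_\<mu> by (rule F_lsc[unfolded lsc_fun_def, rule_format]) (rule z)
    also have "\<dots> \<le> ereal (F (moment \<nu>))"
    proof (rule Liminf_le)
      show "\<forall>\<^sub>F j in sequentially. ereal (F (y (r j))) \<le> ereal (F (moment \<nu>))"
        using le le_trans[OF _ seq_suble[OF r]] by (intro eventually_sequentiallyI[of 1]) simp
    qed simp
    finally show ?thesis by simp
  qed
  then have "optimal_inv ?X ?f F \<mu>"
    using inv by (simp add: optimal_inv_def)
  then show ?thesis
    using r z by (intro exI[of _ \<mu>] conjI exI[of _ r] allI) (simp_all add: moment_\<mu>)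
qed

end
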